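(* Let $f$ be a smooth diffeomorphism of a compact $d$-dimensional Riemannian manifold $M$ preserving a smooth probability measure $\mu$. For $x,y\in M$ let $d_n^{(r)}(x,y)$ be the $r$-th smallest among $d(x,fy),\dots,d(x,f^ny)$. Suppose that the periodic points of $f$ are dense in $M$. (a) If for every $x\in M$ and for $\mu$-a.e. $y\in M$ one has $\limsup_{n\to\infty}\dfrac{|\ln d_n^{(1)}(x,y)|-\frac1d\ln n}{\ln\ln n}=\dfrac1d$, then the set $$\mathcal H=\Big\{x\in M:\text{ for }\mu\text{-a.e. }y,\text{ for all }r\ge1,\ \limsup_{n\to\infty}\frac{|\ln d_n^{(r)}(x,y)|-\frac1d\ln n}{\ln\ln n}=\frac1d\Big\}$$ contains a dense $G_\delta$ set. (b) For any function $\zeta:\mathbb N\to\mathbb N^*$, the set $$\bar{\mathcal H}_\zeta=\Big\{x\in M:\text{ for all }r\ge1,\ \limsup_{n\to\infty}\frac{|\ln d_n^{(r)}(x,x)|}{\zeta(n)}=\infty\Big\}$$ contains a dense $G_\delta$ set.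
   Context: Here $d(\cdot,\cdot)$ is the Riemannian distance, $|\ln 0|=\infty$, and a smooth measure is a measure with smooth positive density with respect to Riemannian volume. $\mathbb N^*$ denotes the positive integers. *)

theory Defs
  imports "HOL-Probability.Probability"
begin

section \<open>Smooth maps between open subsets of Euclidean spaces\<close>

text \<open>\<open>C\<^sup>k\<close> on an open set: all iterated directional derivatives up to order \<open>k\<close> exist in the
  Frechet sense and are continuous. Only used for open \<open>S\<close>.\<close>

primrec Ck_on :: "nat \<Rightarrow> 'a::euclidean_space set \<Rightarrow> ('a \<Rightarrow> 'b::euclidean_space) \<Rightarrow> bool" where
  "Ck_on 0 S h \<longleftrightarrow> continuous_on S h"
| "Ck_on (Suc k) S h \<longleftrightarrow>
     (\<forall>x\<in>S. h differentiable (at x)) \<and> (\<forall>v. Ck_on k S (\<lambda>x. frechet_derivative h (at x) v))"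

definition smooth_on :: "'a::euclidean_space set \<Rightarrow> ('a \<Rightarrow> 'b::euclidean_space) \<Rightarrow> bool" where
  "smooth_on S h \<longleftrightarrow> (\<forall>k. Ck_on k S h)"


section \<open>Smooth manifolds\<close>

text \<open>The manifold is the whole type \<open>'m\<close>; its dimension is \<open>CARD('d)\<close>, hence arbitrary but at
  least 1. A chart is a pair of its domain and its coordinate map; outside the domain the
  coordinate map is irrelevant.\<close>

type_synonym ('m, 'd) chart = "'m set \<times> ('m \<Rightarrow> real ^ 'd)"

abbreviation chart_dom :: "('m, 'd) chart \<Rightarrow> 'm set" where
  "chart_dom c \<equiv> fst c"

abbreviation coord :: "('m, 'd) chart \<Rightarrow> 'm \<Rightarrow> real ^ 'd" where
  "coord c \<equiv> snd c"

abbreviation param :: "('m, 'd) chart \<Rightarrow> real ^ 'd \<Rightarrow> 'm" where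
  "param c \<equiv> inv_into (chart_dom c) (coord c)"

abbreviation chart_image :: "('m, 'd) chart \<Rightarrow> (real ^ 'd) set" where
  "chart_image c \<equiv> coord c ` chart_dom c"

definition is_chart :: "('m::topological_space, 'd::finite) chart \<Rightarrow> bool" where
  "is_chart c \<longleftrightarrow> open (chart_dom c) \<and> open (chart_image c) \<and>
     homeomorphism (chart_dom c) (chart_image c) (coord c) (param c)"

text \<open>The atlas need not be maximal: every notion below gives the same result for all atlases of
  the same smooth structure.\<close>

definition smooth_atlas :: "('m::topological_space, 'd::finite) chart set \<Rightarrow> bool" where
  "smooth_atlas A \<longleftrightarrow>
     (\<forall>c\<in>A. is_chart c) \<and> (\<Union>c\<in>A. chart_dom c) = UNIV \<and>
     (\<forall>c\<in>A. \<forall>c'\<in>A. smooth_on (coord c ` (chart_dom c \<inter> chart_dom c')) (coord c' \<circ> param c))"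

definition smooth_map :: "('m::topological_space, 'd::finite) chart set \<Rightarrow> ('m \<Rightarrow> 'm) \<Rightarrow> bool" where
  "smooth_map A f \<longleftrightarrow> continuous_on UNIV f \<and>
     (\<forall>c\<in>A. \<forall>c'\<in>A. smooth_on (coord c ` (chart_dom c \<inter> f -` chart_dom c')) (coord c' \<circ> f \<circ> param c))"

definition smooth_diffeo :: "('m::topological_space, 'd::finite) chart set \<Rightarrow> ('m \<Rightarrow> 'm) \<Rightarrow> bool" where
  "smooth_diffeo A f \<longleftrightarrow> bij f \<and> smooth_map A f \<and> smooth_map A (inv f)"

definition smooth_function :: "('m::topological_space, 'd::finite) chart set \<Rightarrow> ('m \<Rightarrow> real) \<Rightarrow> bool" where
  "smooth_function A h \<longleftrightarrow> (\<forall>c\<in>A. smooth_on (chart_image c) (h \<circ> param c))"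


section \<open>Riemannian metrics, distance and volume\<close>

text \<open>A Riemannian metric is a smooth, symmetric, positive definite covariant 2-tensor field, given by
  its components: \<open>g c p\<close> is the matrix of the metric at the point \<open>p\<close> in the chart \<open>c\<close>. The last
  clause is the transformation law of covariant 2-tensors.\<close>

type_synonym ('m, 'd) metric_tensor = "('m, 'd) chart \<Rightarrow> 'm \<Rightarrow> real ^ 'd ^ 'd"

definition riemannian_metric ::
  "('m::topological_space, 'd::finite) chart set \<Rightarrow> ('m, 'd) metric_tensor \<Rightarrow> bool" where
  "riemannian_metric A g \<longleftrightarrow>
     (\<forall>c\<in>A. smooth_on (chart_image c) (\<lambda>u. g c (param c u))) \<and>
     (\<forall>c\<in>A. \<forall>p\<in>chart_dom c. transpose (g c p) = g c p \<and> (\<forall>v. v \<noteq> 0 \<longrightarrow> v \<bullet> (g c p *v v) > 0)) \<and>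
     (\<forall>c\<in>A. \<forall>c'\<in>A. \<forall>p\<in>chart_dom c \<inter> chart_dom c'.
        let J = matrix (frechet_derivative (coord c' \<circ> param c) (at (coord c p)))
        in g c p = transpose J ** g c' p ** J)"

text \<open>Curves that are \<open>C\<^sup>1\<close> on the closed interval, with one-sided derivatives at its end points.\<close>

definition C1_curve_on ::
  "('m::topological_space, 'd::finite) chart set \<Rightarrow> real \<Rightarrow> real \<Rightarrow> (real \<Rightarrow> 'm) \<Rightarrow> bool" where
  "C1_curve_on A a b \<gamma> \<longleftrightarrow> continuous_on {a..b} \<gamma> \<and>
     (\<forall>c\<in>A. \<exists>D.
        (\<forall>t \<in> {a..b} \<inter> \<gamma> -` chart_dom c.
           ((coord c \<circ> \<gamma>) has_vector_derivative D t) (at t within {a..b})) \<and>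
        continuous_on ({a..b} \<inter> \<gamma> -` chart_dom c) D)"

text \<open>\<open>S\<close> is the set of division points of \<open>[0,1]\<close>.\<close>

definition piecewise_C1_curve ::
  "('m::topological_space, 'd::finite) chart set \<Rightarrow> (real \<Rightarrow> 'm) \<Rightarrow> bool" where
  "piecewise_C1_curve A \<gamma> \<longleftrightarrow>
     (\<exists>S. finite S \<and> {0, 1} \<subseteq> S \<and> S \<subseteq> {0..1} \<and>
        (\<forall>a\<in>S. \<forall>b\<in>S. a < b \<and> {a<..<b} \<inter> S = {} \<longrightarrow> C1_curve_on A a b \<gamma>))"

text \<open>By the transformation law the speed does not depend on the chart chosen around \<open>\<gamma> t\<close>. At the
  finitely many division points it may be meaningless, which does not affect the length.\<close>

definition curve_speed ::
  "('m::topological_space, 'd::finite) chart set \<Rightarrow> ('m, 'd) metric_tensor \<Rightarrow> (real \<Rightarrow> 'm) \<Rightarrow> real \<Rightarrow> real" where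
  "curve_speed A g \<gamma> t =
     (let c = (SOME c. c \<in> A \<and> \<gamma> t \<in> chart_dom c);
          v = vector_derivative (coord c \<circ> \<gamma>) (at t)
      in sqrt (v \<bullet> (g c (\<gamma> t) *v v)))"

definition curve_length ::
  "('m::topological_space, 'd::finite) chart set \<Rightarrow> ('m, 'd) metric_tensor \<Rightarrow> (real \<Rightarrow> 'm) \<Rightarrow> ennreal" where
  "curve_length A g \<gamma> = (\<integral>\<^sup>+t\<in>{0..1}. ennreal (curve_speed A g \<gamma> t) \<partial>lborel)"

text \<open>The manifold is not required to be connected: points of different components are at distance
  \<open>\<infinity>\<close>, the infimum of the empty set.\<close>

definition riemannian_dist ::
  "('m::topological_space, 'd::finite) chart set \<Rightarrow> ('m, 'd) metric_tensor \<Rightarrow> 'm \<Rightarrow> 'm \<Rightarrow> ennreal" where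
  "riemannian_dist A g x y =
     (INF \<gamma>\<in>{\<gamma>. piecewise_C1_curve A \<gamma> \<and> \<gamma> 0 = x \<and> \<gamma> 1 = y}. curve_length A g \<gamma>)"

text \<open>The Riemannian volume is the Borel measure with density \<open>sqrt (det g)\<close> in every chart.\<close>

definition riemannian_volume ::
  "('m::topological_space, 'd::finite) chart set \<Rightarrow> ('m, 'd) metric_tensor \<Rightarrow> 'm measure \<Rightarrow> bool" where
  "riemannian_volume A g vol \<longleftrightarrow> sets vol = sets borel \<and>
     (\<forall>c\<in>A. \<forall>B\<in>sets borel. B \<subseteq> chart_dom c \<longrightarrow>
        emeasure vol B = (\<integral>\<^sup>+u\<in>coord c ` B. ennreal (sqrt (det (g c (param c u)))) \<partial>lborel))"

definition smooth_measure ::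
  "('m::topological_space, 'd::finite) chart set \<Rightarrow> ('m, 'd) metric_tensor \<Rightarrow> 'm measure \<Rightarrow> bool" where
  "smooth_measure A g \<mu> \<longleftrightarrow>
     (\<exists>vol \<rho>. riemannian_volume A g vol \<and> smooth_function A \<rho> \<and> (\<forall>x. \<rho> x > 0) \<and>
        \<mu> = density vol (\<lambda>x. ennreal (\<rho> x)))"


section \<open>Closest returns\<close>

text \<open>The \<open>r\<close>-th smallest (with multiplicity) of \<open>dist x (f y), \<dots>, dist x (f\<^sup>n y)\<close>; meaningful only for
  \<open>1 \<le> r \<le> n\<close>. The finitely many \<open>n < r\<close> play no role in a limit superior as \<open>n\<close> tends to infinity.\<close>

definition nth_closest ::
  "('m \<Rightarrow> 'm \<Rightarrow> ennreal) \<Rightarrow> ('m \<Rightarrow> 'm) \<Rightarrow> nat \<Rightarrow> nat \<Rightarrow> 'm \<Rightarrow> 'm \<Rightarrow> ennreal" where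
  "nth_closest dst f r n x y = sort (map (\<lambda>k. dst x ((f ^^ k) y)) [1..<Suc n]) ! (r - 1)"

definition abs_ln :: "ennreal \<Rightarrow> ereal" where
  "abs_ln a = (if a = 0 \<or> a = \<infinity> then \<infinity> else ereal \<bar>ln (enn2real a)\<bar>)"

definition periodic_points :: "('m \<Rightarrow> 'm) \<Rightarrow> 'm set" where
  "periodic_points f = {x. \<exists>p\<ge>1. (f ^^ p) x = x}"

definition contains_dense_gdelta :: "'m::topological_space set \<Rightarrow> bool" where
  "contains_dense_gdelta H \<longleftrightarrow> (\<exists>G. gdelta G \<and> closure G = UNIV \<and> G \<subseteq> H)"

end

theory Submission
  imports Defs "HOL-Real_Asymp.Real_Asymp"
begin

text \<open>Let \<open>x\<close> have period \<open>p\<close>. An orbit that comes \<open>\<delta>\<close>-close to \<open>x\<close> stays close to the periodic orbit and is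
  therefore close to \<open>x\<close> again \<open>p\<close>, \<open>2p\<close>, \<open>\<dots>\<close> steps later; after \<open>r\<close> such returns the distance is at most
  \<open>L\<^sup>r\<^sup>p \<delta>\<close>, where \<open>L \<ge> 1\<close> is a Lipschitz constant of \<open>f\<close>. Both the factor and the delay are bounded, hence
  invisible on the scale of \<open>ln (ln n)\<close>. So at a periodic point the \<open>r\<close>-th closest approach obeys the same
  logarithm law as the first one (\<open>frequently_hits_at_periodic\<close>), and the point itself returns exactly,
  infinitely often.

  Periodic points are thus as recurrent as required. The passage from them to a generic point rests on
  the fact that being hit \<open>r\<close> times up to a given time within a given distance, by a set of orbits of
  measure larger than a given number, survives a small change of the target \<open>x\<close> at the cost of a slightly
  larger distance (\<open>hits_perturb\<close>). For each \<open>R\<close> there is one such condition, with \<open>R\<close> hits up to some time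
  not before \<open>R\<close> and parameters that approach the critical ones as \<open>R\<close> grows. It holds in a neighbourhood
  of every periodic point, so by Baire's theorem all these conditions hold together on a dense \<open>G\<^sub>\<delta>\<close> set
  (\<open>contains_dense_gdelta_INT\<close>), and together they give the lower bounds for the limits superior. The upper bound in the logarithm law for the \<open>r\<close>-th distance follows from the
  one for the first distance, which is smaller.

  The argument uses upper bounds for the Riemannian distance: the triangle inequality, the fact that
  points that are close in the manifold topology have small distance, and the Lipschitz property of smooth
  maps on a compact manifold (\<open>riemannian_dist_triangle\<close>, \<open>riemannian_dist_small\<close>,
  \<open>riemannian_dist_lipschitz\<close>). They are obtained from explicit curves: concatenations, segments in a chart,
  and images of curves.\<close>

section \<open>Smooth maps and curves in charts\<close>

definition metric_norm :: "('m, 'd::finite) metric_tensor \<Rightarrow> ('m, 'd) chart \<Rightarrow> 'm \<Rightarrow> real ^ 'd \<Rightarrow> real" where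
  "metric_norm g c p v = sqrt (v \<bullet> (g c p *v v))"

text \<open>In the charts \<open>c\<close> and \<open>c'\<close> this is the tangent map of \<open>F\<close>; for \<open>F = id\<close> it is the Jacobian of the
  change of charts.\<close>

definition chart_deriv ::
  "('m \<Rightarrow> 'm) \<Rightarrow> ('m, 'd::finite) chart \<Rightarrow> ('m, 'd) chart \<Rightarrow> real ^ 'd \<Rightarrow> real ^ 'd \<Rightarrow> real ^ 'd" where
  "chart_deriv F c c' u = frechet_derivative (coord c' \<circ> F \<circ> param c) (at u)"

locale riemannian_atlas =
  fixes A :: "('m::t2_space, 'd::finite) chart set"
    and g :: "('m, 'd) metric_tensor"
  assumes atlas: "smooth_atlas A"
    and metric: "riemannian_metric A g"
begin

lemma chart_at: "\<exists>c\<in>A. p \<in> chart_dom c"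
  using atlas unfolding smooth_atlas_def by (metis UNIV_I UN_E)

lemma
  assumes "c \<in> A"
  shows open_chart_dom: "open (chart_dom c)"
    and open_chart_image: "open (chart_image c)"
    and continuous_on_coord: "continuous_on (chart_dom c) (coord c)"
    and continuous_on_param: "continuous_on (chart_image c) (param c)"
    and param_coord: "\<And>p. p \<in> chart_dom c \<Longrightarrow> param c (coord c p) = p"
    and coord_param: "\<And>u. u \<in> chart_image c \<Longrightarrow> coord c (param c u) = u"
    and param_in_dom: "\<And>u. u \<in> chart_image c \<Longrightarrow> param c u \<in> chart_dom c"
proof -
  have *: "is_chart c" using atlas assms unfolding smooth_atlas_def by blast
  then show "open (chart_dom c)" "open (chart_image c)"
    "continuous_on (chart_dom c) (coord c)" "continuous_on (chart_image c) (param c)"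
    "\<And>p. p \<in> chart_dom c \<Longrightarrow> param c (coord c p) = p"
    unfolding is_chart_def homeomorphism_def by auto
  show "\<And>u. u \<in> chart_image c \<Longrightarrow> coord c (param c u) = u"
    "\<And>u. u \<in> chart_image c \<Longrightarrow> param c u \<in> chart_dom c"
    by (auto intro: f_inv_into_f inv_into_into)
qed

lemma smooth_map_id: "smooth_map A id"
  using atlas unfolding smooth_map_def smooth_atlas_def by (simp add: continuous_on_id)

lemma
  assumes F: "smooth_map A F" and c: "c \<in> A" "c' \<in> A"
    and u: "u \<in> coord c ` (chart_dom c \<inter> F -` chart_dom c')"
  shows has_derivative_chart_deriv:
      "((coord c' \<circ> F \<circ> param c) has_derivative chart_deriv F c c' u) (at u)"
    and linear_chart_deriv: "linear (chart_deriv F c c' u)"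
proof -
  have "smooth_on (coord c ` (chart_dom c \<inter> F -` chart_dom c')) (coord c' \<circ> F \<circ> param c)"
    using F c unfolding smooth_map_def by blast
  then have "Ck_on (Suc 0) (coord c ` (chart_dom c \<inter> F -` chart_dom c')) (coord c' \<circ> F \<circ> param c)"
    unfolding smooth_on_def by blast
  then have "(coord c' \<circ> F \<circ> param c) differentiable (at u)"
    using u by auto
  then show "((coord c' \<circ> F \<circ> param c) has_derivative chart_deriv F c c' u) (at u)"
    unfolding chart_deriv_def by (simp add: frechet_derivative_works)
  then show "linear (chart_deriv F c c' u)"
    by (rule has_derivative_linear)
qed

text \<open>Smoothness only gives continuity in the base point for each fixed direction. Linearity in the
  direction, expanded over the finite basis, upgrades this to joint continuity.\<close>

lemma continuous_on_chart_deriv: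
  assumes F: "smooth_map A F" and c: "c \<in> A" "c' \<in> A"
    and h: "continuous_on T h" "\<And>s. s \<in> T \<Longrightarrow> h s \<in> coord c ` (chart_dom c \<inter> F -` chart_dom c')"
    and w: "continuous_on T w"
  shows "continuous_on T (\<lambda>s. chart_deriv F c c' (h s) (w s))"
proof -
  let ?S = "coord c ` (chart_dom c \<inter> F -` chart_dom c')"
  have "smooth_on ?S (coord c' \<circ> F \<circ> param c)"
    using F c unfolding smooth_map_def by blast
  then have "Ck_on (Suc 0) ?S (coord c' \<circ> F \<circ> param c)"
    unfolding smooth_on_def by blast
  then have *: "continuous_on ?S (\<lambda>u. chart_deriv F c c' u v)" for v
    unfolding chart_deriv_def by auto
  have "continuous_on T (\<lambda>s. chart_deriv F c c' (h s) v)" for v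
    using continuous_on_compose2[OF * h(1)] h(2) by blast
  then have **: "continuous_on T (\<lambda>s. \<Sum>i\<in>Basis. (w s \<bullet> i) *\<^sub>R chart_deriv F c c' (h s) i)"
    by (intro continuous_intros w)
  have "chart_deriv F c c' (h s) (w s) = (\<Sum>i\<in>Basis. (w s \<bullet> i) *\<^sub>R chart_deriv F c c' (h s) i)"
    if "s \<in> T" for s
  proof -
    interpret L: linear "chart_deriv F c c' (h s)"
      using linear_chart_deriv[OF F c h(2)[OF that]] .
    have "chart_deriv F c c' (h s) (w s) = chart_deriv F c c' (h s) (\<Sum>i\<in>Basis. (w s \<bullet> i) *\<^sub>R i)"
      by (simp add: euclidean_representation)
    also have "\<dots> = (\<Sum>i\<in>Basis. (w s \<bullet> i) *\<^sub>R chart_deriv F c c' (h s) i)"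
      by (simp add: L.sum L.scale)
    finally show ?thesis .
  qed
  then show ?thesis using ** continuous_on_cong by fastforce
qed

lemma continuous_on_metric_norm:
  assumes c: "c \<in> A" and p: "continuous_on T p" "\<And>s. s \<in> T \<Longrightarrow> p s \<in> chart_dom c"
    and w: "continuous_on T w"
  shows "continuous_on T (\<lambda>s. metric_norm g c (p s) (w s))"
proof -
  have "smooth_on (chart_image c) (\<lambda>u. g c (param c u))"
    using metric c unfolding riemannian_metric_def by blast
  then have "Ck_on 0 (chart_image c) (\<lambda>u. g c (param c u))"
    unfolding smooth_on_def by blast
  then have 1: "continuous_on (chart_image c) (\<lambda>u. g c (param c u))" by simp
  have 2: "continuous_on T (\<lambda>s. coord c (p s))"
    using continuous_on_compose2[OF continuous_on_coord[OF c] p(1)] p(2) by blast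
  have "continuous_on T (\<lambda>s. g c (param c (coord c (p s))))"
    using continuous_on_compose2[OF 1 2] p(2) by blast
  then have 3: "continuous_on T (\<lambda>s. g c (p s))"
    using p(2) param_coord[OF c] by (simp cong: continuous_on_cong)
  show ?thesis
    unfolding metric_norm_def matrix_vector_mult_def
    by (intro continuous_intros w 3 continuous_on_vec_lambda)
qed

lemma metric_norm_pos:
  assumes "c \<in> A" "p \<in> chart_dom c" "v \<noteq> 0"
  shows "metric_norm g c p v > 0"
  using metric assms unfolding riemannian_metric_def metric_norm_def by auto

lemma metric_norm_scale: "metric_norm g c p (a *\<^sub>R v) = \<bar>a\<bar> * metric_norm g c p v"
  unfolding metric_norm_def
  by (simp add: matrix_vector_mult_scaleR real_sqrt_mult mult.assoc[symmetric] real_sqrt_abs2)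

text \<open>The transformation law of the metric tensor, read as: the norm of a tangent vector does not depend
  on the chart that represents it.\<close>

lemma metric_norm_chart:
  assumes c: "c \<in> A" "c' \<in> A" and p: "p \<in> chart_dom c" "p \<in> chart_dom c'"
  shows "metric_norm g c' p (chart_deriv id c c' (coord c p) v) = metric_norm g c p v"
proof -
  let ?J = "matrix (chart_deriv id c c' (coord c p))"
  have lin: "linear (chart_deriv id c c' (coord c p))"
    by (rule linear_chart_deriv[OF smooth_map_id c]) (use p in auto)
  have "g c p = transpose ?J ** g c' p ** ?J"
    using metric c p unfolding riemannian_metric_def Let_def chart_deriv_def comp_id by blast
  then have "v \<bullet> (g c p *v v) = v \<bullet> (transpose ?J *v (g c' p *v (?J *v v)))"
    by (simp add: matrix_vector_mul_assoc matrix_mul_assoc)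
  also have "\<dots> = (?J *v v) \<bullet> (g c' p *v (?J *v v))"
    by (metis dot_lmul_matrix vector_transpose_matrix)
  finally show ?thesis
    unfolding metric_norm_def by (metis matrix_vector_mul(2)[OF lin])
qed

text \<open>Near \<open>t\<close> the curve stays in the domain of \<open>c\<close>, so there the image curve is the coordinate
  representation of \<open>F\<close> applied to the curve in coordinates. The case \<open>F = id\<close> compares the velocities
  of one curve in two charts.\<close>

lemma chart_chain_rule:
  assumes F: "smooth_map A F" and c: "c \<in> A" "c' \<in> A"
    and \<gamma>: "continuous_on T \<gamma>" and t: "t \<in> T" "\<gamma> t \<in> chart_dom c" "F (\<gamma> t) \<in> chart_dom c'"
    and v: "((coord c \<circ> \<gamma>) has_vector_derivative v) (at t within T)"
  shows "((coord c' \<circ> (F \<circ> \<gamma>)) has_vector_derivative chart_deriv F c c' (coord c (\<gamma> t)) v) (at t within T)"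
proof -
  let ?J = "chart_deriv F c c' (coord c (\<gamma> t))"
  have u: "coord c (\<gamma> t) \<in> coord c ` (chart_dom c \<inter> F -` chart_dom c')" using t by auto
  have J: "((coord c' \<circ> F \<circ> param c) has_derivative ?J) (at ((coord c \<circ> \<gamma>) t))"
    using has_derivative_chart_deriv[OF F c u] by simp
  interpret L: linear ?J by (rule linear_chart_deriv[OF F c u])
  have 1: "((coord c' \<circ> F \<circ> param c) \<circ> (coord c \<circ> \<gamma>) has_vector_derivative ?J v) (at t within T)"
    using diff_chain_within[OF v[unfolded has_vector_derivative_def] has_derivative_at_withinI[OF J]]
    unfolding has_vector_derivative_def by (simp add: o_def L.scale)
  have "(\<gamma> \<longlongrightarrow> \<gamma> t) (at t within T)"
    using \<gamma> t(1) by (simp add: continuous_on_def)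
  then have "\<forall>\<^sub>F s in at t within T. \<gamma> s \<in> chart_dom c"
    using topological_tendstoD open_chart_dom[OF c(1)] t(2) by blast
  then have "\<forall>\<^sub>F s in at t within T. ((coord c' \<circ> F \<circ> param c) \<circ> (coord c \<circ> \<gamma>)) s = (coord c' \<circ> (F \<circ> \<gamma>)) s"
    by eventually_elim (simp add: param_coord[OF c(1)])
  then show ?thesis
    using 1 t param_coord[OF c(1)] unfolding has_vector_derivative_def
    by (auto elim!: has_derivative_transform_eventually)
qed

text \<open>A curve has to be \<open>C\<^sup>1\<close> in every chart of the atlas, while it is usually known to be so in one chart
  around each of its points only. The chain rule transfers the property from there to all charts; with a
  general \<open>F\<close> it covers images of curves at the same time.\<close>

lemma C1_curve_on_image:
  assumes F: "smooth_map A F" and "a < b" and \<gamma>: "continuous_on {a..b} \<gamma>"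
    and loc: "\<And>t. t \<in> {a..b} \<Longrightarrow> \<exists>c\<in>A. \<exists>U D. open U \<and> t \<in> U \<and> \<gamma> ` ({a..b} \<inter> U) \<subseteq> chart_dom c \<and>
      (\<forall>s\<in>{a..b} \<inter> U. ((coord c \<circ> \<gamma>) has_vector_derivative D s) (at s within {a..b})) \<and>
      continuous_on ({a..b} \<inter> U) D"
  shows "C1_curve_on A a b (F \<circ> \<gamma>)"
  unfolding C1_curve_on_def
proof (intro conjI ballI)
  have F_cont: "continuous_on UNIV F" using F unfolding smooth_map_def by blast
  show F\<gamma>: "continuous_on {a..b} (F \<circ> \<gamma>)"
    using continuous_on_compose[OF \<gamma>] F_cont continuous_on_subset by blast
  fix c' assume c': "c' \<in> A"
  let ?T = "{a..b} \<inter> (F \<circ> \<gamma>) -` chart_dom c'"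
  define D' where "D' t = vector_derivative (coord c' \<circ> (F \<circ> \<gamma>)) (at t within {a..b})" for t
  have ex: "\<exists>V. open V \<and> t \<in> V \<and> continuous_on (?T \<inter> V) D' \<and>
    ((coord c' \<circ> (F \<circ> \<gamma>)) has_vector_derivative D' t) (at t within {a..b})" if t: "t \<in> ?T" for t
  proof -
    obtain c U D where c: "c \<in> A" and U: "open U" "t \<in> U" "\<gamma> ` ({a..b} \<inter> U) \<subseteq> chart_dom c"
      and D: "\<forall>s\<in>{a..b} \<inter> U. ((coord c \<circ> \<gamma>) has_vector_derivative D s) (at s within {a..b})"
        "continuous_on ({a..b} \<inter> U) D"
      using loc[of t] t by auto
    have der: "((coord c' \<circ> (F \<circ> \<gamma>)) has_vector_derivative chart_deriv F c c' (coord c (\<gamma> s)) (D s)) (at s within {a..b})"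
      if "s \<in> ?T \<inter> U" for s
      by (rule chart_chain_rule[OF F c c' \<gamma>]) (use that U D in auto)
    have eq: "D' s = chart_deriv F c c' (coord c (\<gamma> s)) (D s)" if "s \<in> ?T \<inter> U" for s
      unfolding D'_def
      by (rule vector_derivative_within_closed_interval[OF \<open>a < b\<close> _ der[OF that]]) (use that in auto)
    have "continuous_on (?T \<inter> U) (\<lambda>s. chart_deriv F c c' (coord c (\<gamma> s)) (D s))"
    proof (rule continuous_on_chart_deriv[OF F c c'])
      show "continuous_on (?T \<inter> U) (\<lambda>s. coord c (\<gamma> s))"
        by (rule continuous_on_compose2[OF continuous_on_coord[OF c] continuous_on_subset[OF \<gamma>]])
          (use U in auto)
      show "continuous_on (?T \<inter> U) D"
        using D(2) by (rule continuous_on_subset) auto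
      show "coord c (\<gamma> s) \<in> coord c ` (chart_dom c \<inter> F -` chart_dom c')" if "s \<in> ?T \<inter> U" for s
        using that U(3) by (intro imageI) auto
    qed
    then have "continuous_on (?T \<inter> U) D'"
      by (rule continuous_on_eq) (simp only: eq)
    moreover have "((coord c' \<circ> (F \<circ> \<gamma>)) has_vector_derivative D' t) (at t within {a..b})"
      using der[of t] eq[of t] t U by auto
    ultimately show ?thesis using U by blast
  qed
  have "continuous_on ?T D'"
    unfolding continuous_on_eq_continuous_within
  proof
    fix t assume t: "t \<in> ?T"
    then obtain V where V: "open V" "t \<in> V" "continuous_on (?T \<inter> V) D'" using ex by blast
    then have "continuous (at t within (?T \<inter> V)) D'"
      using t by (auto simp: continuous_on_eq_continuous_within)
    moreover have "at t within (?T \<inter> V) = at t within ?T"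
      by (rule at_within_nhd[OF V(2,1)]) auto
    ultimately show "continuous (at t within ?T) D'" by simp
  qed
  then show "\<exists>D. (\<forall>t\<in>?T. ((coord c' \<circ> (F \<circ> \<gamma>)) has_vector_derivative D t) (at t within {a..b})) \<and>
    continuous_on ?T D"
    using ex by blast
qed

lemma C1_curve_on_compose:
  assumes F: "smooth_map A F" and "a < b" and \<gamma>: "C1_curve_on A a b \<gamma>"
  shows "C1_curve_on A a b (F \<circ> \<gamma>)"
proof (rule C1_curve_on_image[OF F \<open>a < b\<close>])
  show cont: "continuous_on {a..b} \<gamma>" using \<gamma> unfolding C1_curve_on_def by blast
  fix t assume t: "t \<in> {a..b}"
  obtain c where c: "c \<in> A" "\<gamma> t \<in> chart_dom c" using chart_at by blast
  obtain D where D: "\<forall>t \<in> {a..b} \<inter> \<gamma> -` chart_dom c.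
           ((coord c \<circ> \<gamma>) has_vector_derivative D t) (at t within {a..b})"
        "continuous_on ({a..b} \<inter> \<gamma> -` chart_dom c) D"
    using \<gamma> c unfolding C1_curve_on_def by blast
  obtain U where U: "open U" "{a..b} \<inter> \<gamma> -` chart_dom c = {a..b} \<inter> U"
    using continuous_on_open_invariant[THEN iffD1, OF cont, rule_format, OF open_chart_dom[OF c(1)]]
    by (metis inf_commute)
  show "\<exists>c\<in>A. \<exists>U D. open U \<and> t \<in> U \<and> \<gamma> ` ({a..b} \<inter> U) \<subseteq> chart_dom c \<and>
      (\<forall>s\<in>{a..b} \<inter> U. ((coord c \<circ> \<gamma>) has_vector_derivative D s) (at s within {a..b})) \<and>
      continuous_on ({a..b} \<inter> U) D"
    using c D U t by (intro bexI[OF _ c(1)] exI[of _ U] exI[of _ D]) auto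
qed

end

lemma C1_curve_on_reparam:
  assumes \<gamma>: "C1_curve_on A a b \<gamma>" and "m > 0" and ab: "a = m * a' + q" "b = m * b' + q"
    and eq: "\<And>t. t \<in> {a'..b'} \<Longrightarrow> \<gamma>' t = \<gamma> (m * t + q)"
  shows "C1_curve_on A a' b' \<gamma>'"
  unfolding C1_curve_on_def
proof (intro conjI ballI)
  have mem: "m * t + q \<in> {a..b}" if "t \<in> {a'..b'}" for t
    using that \<open>m > 0\<close> unfolding ab by auto
  have "continuous_on {a'..b'} (\<lambda>t. \<gamma> (m * t + q))"
  proof (rule continuous_on_compose2[where g = \<gamma> and t = "{a..b}"])
    show "continuous_on {a..b} \<gamma>" using \<gamma> unfolding C1_curve_on_def by blast
    show "continuous_on {a'..b'} (\<lambda>t. m * t + q)" by (intro continuous_intros)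
  qed (use mem in auto)
  then show "continuous_on {a'..b'} \<gamma>'"
    by (rule continuous_on_eq) (simp add: eq)
  fix c assume "c \<in> A"
  then obtain D where D: "\<forall>t \<in> {a..b} \<inter> \<gamma> -` chart_dom c.
           ((coord c \<circ> \<gamma>) has_vector_derivative D t) (at t within {a..b})"
        "continuous_on ({a..b} \<inter> \<gamma> -` chart_dom c) D"
    using \<gamma> unfolding C1_curve_on_def by blast
  let ?T = "{a'..b'} \<inter> \<gamma>' -` chart_dom c"
  show "\<exists>D. (\<forall>t\<in>?T. ((coord c \<circ> \<gamma>') has_vector_derivative D t) (at t within {a'..b'})) \<and>
        continuous_on ?T D"
  proof (intro exI[of _ "\<lambda>t. m *\<^sub>R D (m * t + q)"] conjI ballI)
    fix t assume t: "t \<in> ?T"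
    have "((coord c \<circ> \<gamma>) has_vector_derivative D (m * t + q)) (at (m * t + q) within {a..b})"
      using D(1) mem t eq by auto
    then have "((coord c \<circ> \<gamma>) has_vector_derivative D (m * t + q))
        (at (m * t + q) within (\<lambda>t. m * t + q) ` {a'..b'})"
      by (rule has_vector_derivative_within_subset) (use mem in auto)
    moreover have "((\<lambda>t. m * t + q) has_vector_derivative m) (at t within {a'..b'})"
      unfolding has_vector_derivative_def by (auto intro!: derivative_eq_intros)
    ultimately have "(((coord c \<circ> \<gamma>) \<circ> (\<lambda>t. m * t + q)) has_vector_derivative m *\<^sub>R D (m * t + q))
        (at t within {a'..b'})"
      using vector_diff_chain_within by blast
    then show "((coord c \<circ> \<gamma>') has_vector_derivative m *\<^sub>R D (m * t + q)) (at t within {a'..b'})"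
      by (rule has_vector_derivative_transform[rotated 2]) (use t eq in auto)
  next
    have "continuous_on ?T (\<lambda>t. D (m * t + q))"
      by (rule continuous_on_compose2[OF D(2)]) (use mem eq in \<open>auto intro!: continuous_intros\<close>)
    then show "continuous_on ?T (\<lambda>t. m *\<^sub>R D (m * t + q))"
      by (intro continuous_intros)
  qed
qed

text \<open>The pieces between neighbouring division points cover \<open>[0,1]\<close> up to the finite set \<open>S\<close>; in this
  form no order on the division points has to be carried along.\<close>

lemma piecewise_C1_curve_pieces:
  assumes "piecewise_C1_curve A \<gamma>"
  shows "\<exists>S. finite S \<and> (\<forall>t\<in>{0..1} - S. \<exists>a b. a < t \<and> t < b \<and> {a..b} \<subseteq> {0..1} \<and> C1_curve_on A a b \<gamma>)"
proof -
  obtain S where S: "finite S" "{0, 1} \<subseteq> S" "S \<subseteq> {0..1}"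
      "\<forall>a\<in>S. \<forall>b\<in>S. a < b \<and> {a<..<b} \<inter> S = {} \<longrightarrow> C1_curve_on A a b \<gamma>"
    using assms unfolding piecewise_C1_curve_def by auto
  show ?thesis
  proof (intro exI[of _ S] conjI ballI S(1))
    fix t assume t: "t \<in> {0..1} - S"
    then have t01: "0 < t" "t < 1" using S(2) by (auto simp: less_le)
    let ?L = "{s\<in>S. s < t}" and ?R = "{s\<in>S. t < s}"
    have fin: "finite ?L" "finite ?R" using S(1) by auto
    have ne: "?L \<noteq> {}" "?R \<noteq> {}" using S(2) t01 by auto
    have L: "Max ?L \<in> ?L" and R: "Min ?R \<in> ?R"
      using Max_in[OF fin(1) ne(1)] Min_in[OF fin(2) ne(2)] by auto
    have disj: "{Max ?L<..<Min ?R} \<inter> S = {}"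
    proof (rule ccontr)
      assume "\<not> ?thesis"
      then obtain s where s: "s \<in> S" "Max ?L < s" "s < Min ?R" by auto
      have "s \<noteq> t" using s t by auto
      then have "s \<in> ?L \<or> s \<in> ?R" using s by auto
      then show False using Max_ge[OF fin(1)] Min_le[OF fin(2)] s leD by blast
    qed
    have "C1_curve_on A (Max ?L) (Min ?R) \<gamma>"
      using S(4) L R disj by auto
    moreover have "{Max ?L..Min ?R} \<subseteq> {0..1}" using L R S(3) by auto
    ultimately show "\<exists>a b. a < t \<and> t < b \<and> {a..b} \<subseteq> {0..1} \<and> C1_curve_on A a b \<gamma>"
      using L R by blast
  qed
qed

lemma piecewise_C1_curve_single:
  assumes "C1_curve_on A 0 1 \<gamma>"
  shows "piecewise_C1_curve A \<gamma>"
  unfolding piecewise_C1_curve_def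
  by (rule exI[of _ "{0, 1}"]) (use assms in auto)

section \<open>Speed and length of curves, and the Lipschitz property of smooth maps\<close>

context riemannian_atlas
begin

lemma metric_norm_zero [simp]: "metric_norm g c p 0 = 0"
  unfolding metric_norm_def by simp

lemma metric_norm_nonneg: "c \<in> A \<Longrightarrow> p \<in> chart_dom c \<Longrightarrow> metric_norm g c p v \<ge> 0"
  using metric_norm_pos[of c p v] by (cases "v = 0") auto

text \<open>The definition of the speed picks some chart; chart independence of the norm makes it computable
  in whichever chart is at hand.\<close>

lemma curve_speed_eq:
  assumes T: "open T" "t \<in> T" and \<gamma>: "continuous_on T \<gamma>"
    and c: "c \<in> A" "\<gamma> t \<in> chart_dom c"
    and v: "((coord c \<circ> \<gamma>) has_vector_derivative v) (at t)"
  shows "curve_speed A g \<gamma> t = metric_norm g c (\<gamma> t) v"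
proof -
  define c' where "c' = (SOME c. c \<in> A \<and> \<gamma> t \<in> chart_dom c)"
  have c': "c' \<in> A" "\<gamma> t \<in> chart_dom c'"
    using someI[of "\<lambda>c. c \<in> A \<and> \<gamma> t \<in> chart_dom c", OF conjI, OF c] unfolding c'_def by auto
  have "((coord c' \<circ> (id \<circ> \<gamma>)) has_vector_derivative chart_deriv id c c' (coord c (\<gamma> t)) v) (at t within T)"
    using v c c'
    by (intro chart_chain_rule[OF smooth_map_id _ _ \<gamma> T(2)]) (auto intro: has_vector_derivative_at_within)
  then have "vector_derivative (coord c' \<circ> \<gamma>) (at t) = chart_deriv id c c' (coord c (\<gamma> t)) v"
    using at_within_open[OF T(2,1)] vector_derivative_at by simp
  then show ?thesis
    using metric_norm_chart[OF c(1) c'(1) c(2) c'(2), of v]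
    unfolding curve_speed_def c'_def[symmetric] Let_def metric_norm_def by simp
qed

lemma curve_speed_C1:
  assumes \<gamma>: "C1_curve_on A a b \<gamma>" and t: "a < t" "t < b" and c: "c \<in> A" "\<gamma> t \<in> chart_dom c"
  obtains v where "((coord c \<circ> \<gamma>) has_vector_derivative v) (at t)"
    "curve_speed A g \<gamma> t = metric_norm g c (\<gamma> t) v"
proof -
  obtain D where D: "\<forall>t \<in> {a..b} \<inter> \<gamma> -` chart_dom c.
           ((coord c \<circ> \<gamma>) has_vector_derivative D t) (at t within {a..b})"
    using \<gamma> c unfolding C1_curve_on_def by blast
  have "((coord c \<circ> \<gamma>) has_vector_derivative D t) (at t within {a..b})"
    using D t c by auto
  then have v: "((coord c \<circ> \<gamma>) has_vector_derivative D t) (at t)"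
    using at_within_Icc_at[OF t] by simp
  have "continuous_on {a<..<b} \<gamma>"
    using \<gamma> unfolding C1_curve_on_def by (meson continuous_on_subset greaterThanLessThan_subseteq_atLeastAtMost_iff order_refl)
  then have "curve_speed A g \<gamma> t = metric_norm g c (\<gamma> t) (D t)"
    by (intro curve_speed_eq[OF _ _ _ c v, of "{a<..<b}"]) (use t in auto)
  then show thesis using that v by blast
qed

lemma continuous_on_curve_speed:
  assumes \<gamma>: "C1_curve_on A a b \<gamma>"
  shows "continuous_on {a<..<b} (curve_speed A g \<gamma>)"
  unfolding continuous_on_eq_continuous_at[OF open_greaterThanLessThan]
proof
  fix t assume t: "t \<in> {a<..<b}"
  obtain c where c: "c \<in> A" "\<gamma> t \<in> chart_dom c" using chart_at by blast
  obtain D where D: "\<forall>t \<in> {a..b} \<inter> \<gamma> -` chart_dom c.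
           ((coord c \<circ> \<gamma>) has_vector_derivative D t) (at t within {a..b})"
      "continuous_on ({a..b} \<inter> \<gamma> -` chart_dom c) D"
    using \<gamma> c unfolding C1_curve_on_def by blast
  have cont: "continuous_on {a<..<b} \<gamma>"
    using \<gamma> unfolding C1_curve_on_def by (meson continuous_on_subset greaterThanLessThan_subseteq_atLeastAtMost_iff order_refl)
  let ?U = "{a<..<b} \<inter> \<gamma> -` chart_dom c"
  have U: "open ?U"
    using continuous_on_open_vimage[OF open_greaterThanLessThan, THEN iffD1, OF cont] open_chart_dom[OF c(1)]
    by (metis inf_commute)
  have eq: "metric_norm g c (\<gamma> s) (D s) = curve_speed A g \<gamma> s" if s: "s \<in> ?U" for s
  proof -
    have "((coord c \<circ> \<gamma>) has_vector_derivative D s) (at s within {a..b})"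
      using D s by auto
    then have "((coord c \<circ> \<gamma>) has_vector_derivative D s) (at s)"
      using at_within_Icc_at[of a s b] s by simp
    then show ?thesis
      using curve_speed_eq[OF _ _ cont c(1)] s by auto
  qed
  have "continuous_on ?U (\<lambda>s. metric_norm g c (\<gamma> s) (D s))"
    by (rule continuous_on_metric_norm[OF c(1)])
      (auto intro: continuous_on_subset[OF cont] continuous_on_subset[OF D(2)])
  then have "continuous_on ?U (curve_speed A g \<gamma>)"
    by (rule continuous_on_eq) (rule eq)
  then show "isCont (curve_speed A g \<gamma>) t"
    using U t c by (simp add: continuous_on_eq_continuous_at)
qed

text \<open>At the division points the speed is an arbitrary value. Cutting out this finite set leaves an integrand
  that is continuous on the rest, hence measurable, so that its integral is additive and homogeneous.\<close>

lemma
  assumes S: "finite S"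
    and pieces: "\<And>t. t \<in> {0..1} - S \<Longrightarrow> \<exists>a b. a < t \<and> t < b \<and> C1_curve_on A a b \<gamma>"
  shows measurable_curve_speed:
      "(\<lambda>t. ennreal (curve_speed A g \<gamma> t) * indicator ({0..1} - S) t) \<in> borel_measurable borel"
    and curve_length_eq:
      "curve_length A g \<gamma> = (\<integral>\<^sup>+t. ennreal (curve_speed A g \<gamma> t) * indicator ({0..1} - S) t \<partial>lborel)"
proof -
  let ?s = "curve_speed A g \<gamma>"
  have "isCont ?s t" if t: "t \<in> {0..1} - S" for t
  proof -
    obtain a b where "a < t" "t < b" "C1_curve_on A a b \<gamma>" using pieces[OF t] by blast
    then show ?thesis
      using continuous_on_eq_continuous_at[OF open_greaterThanLessThan, THEN iffD1, OF continuous_on_curve_speed]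
      by auto
  qed
  then have "continuous_on ({0..1} - S) ?s"
    by (simp add: continuous_at_imp_continuous_on)
  moreover have B: "{0..1} - S \<in> sets borel" using S by (simp add: borel_closed finite_imp_closed)
  ultimately have *: "(\<lambda>t. indicator ({0..1} - S) t *\<^sub>R ?s t) \<in> borel_measurable borel"
    by (intro borel_measurable_continuous_on_indicator)
  have "(\<lambda>t. ennreal (?s t) * indicator ({0..1} - S) t) = (\<lambda>t. ennreal (indicator ({0..1} - S) t *\<^sub>R ?s t))"
    by (auto simp: indicator_def)
  then show "(\<lambda>t. ennreal (?s t) * indicator ({0..1} - S) t) \<in> borel_measurable borel"
    using measurable_compose[OF * measurable_ennreal] by simp
  have "AE t in lborel. t \<notin> S"
    using AE_not_in[OF finite_imp_null_set_lborel[OF S]] .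
  then show "curve_length A g \<gamma> = (\<integral>\<^sup>+t. ennreal (?s t) * indicator ({0..1} - S) t \<partial>lborel)"
    unfolding curve_length_def by (intro nn_integral_cong_AE) (auto simp: indicator_def)
qed

text \<open>The ratio of the two norms is homogeneous of degree 0 in the direction, so it suffices to bound it on
  a compact ball of base points times the unit sphere.\<close>

lemma speed_image_bound_local:
  assumes F: "smooth_map A F"
  shows "\<exists>U L c c'. open U \<and> p0 \<in> U \<and> c \<in> A \<and> c' \<in> A \<and> U \<subseteq> chart_dom c \<inter> F -` chart_dom c' \<and>
    (\<forall>p\<in>U. \<forall>v. metric_norm g c' (F p) (chart_deriv F c c' (coord c p) v) \<le> L * metric_norm g c p v)"
proof -
  obtain c where c: "c \<in> A" "p0 \<in> chart_dom c" using chart_at by blast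
  obtain c' where c': "c' \<in> A" "F p0 \<in> chart_dom c'" using chart_at by blast
  have F_cont: "continuous_on UNIV F" using F unfolding smooth_map_def by blast
  let ?W = "chart_dom c \<inter> F -` chart_dom c'"
  let ?O = "coord c ` ?W"
  have W: "open ?W" using open_chart_dom[OF c(1)] open_chart_dom[OF c'(1)] F_cont
    by (simp add: open_Int open_vimage)
  have "?O = chart_image c \<inter> param c -` ?W"
    using param_coord[OF c(1)] coord_param[OF c(1)] by (auto intro!: image_eqI) 
  then have O: "open ?O"
    using continuous_on_open_vimage[OF open_chart_image[OF c(1)], THEN iffD1, OF continuous_on_param[OF c(1)]] W
    by (metis inf_commute)
  have OW: "param c u \<in> ?W" "coord c (param c u) = u" if "u \<in> ?O" for u
    using that param_coord[OF c(1)] by auto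
  have "coord c p0 \<in> ?O" using c c' by auto
  then obtain r where r: "r > 0" "cball (coord c p0) r \<subseteq> ?O"
    using O open_contains_cball by blast
  let ?K = "cball (coord c p0) r \<times> sphere (0 :: real ^ 'd) 1"
  let ?num = "\<lambda>z. metric_norm g c' (F (param c (fst z))) (chart_deriv F c c' (fst z) (snd z))"
  let ?den = "\<lambda>z. metric_norm g c (param c (fst z)) (snd z)"
  have K: "compact ?K" by (intro compact_Times compact_cball compact_sphere)
  have KO: "fst z \<in> ?O" if "z \<in> ?K" for z using that r by auto
  have c_param: "continuous_on ?K (\<lambda>z. param c (fst z))"
    by (rule continuous_on_compose2[OF continuous_on_param[OF c(1)] continuous_on_fst[OF continuous_on_id]])
      (use KO in blast)
  have c_F: "continuous_on ?K (\<lambda>z. F (param c (fst z)))"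
    using continuous_on_compose2[OF F_cont c_param] by simp
  have c_deriv: "continuous_on ?K (\<lambda>z. chart_deriv F c c' (fst z) (snd z))"
    by (rule continuous_on_chart_deriv[OF F c(1) c'(1)]) (use KO in \<open>auto intro!: continuous_intros\<close>)
  have c_num: "continuous_on ?K ?num"
    by (rule continuous_on_metric_norm[OF c'(1) c_F _ c_deriv]) (use OW(1) KO in auto)
  have c_den: "continuous_on ?K ?den"
    by (rule continuous_on_metric_norm[OF c(1) c_param]) (use OW(1) KO in \<open>auto intro!: continuous_intros\<close>)
  have den: "?den z > 0" if "z \<in> ?K" for z
    using that OW(1)[OF KO[OF that]] by (intro metric_norm_pos[OF c(1)]) auto
  have "continuous_on ?K (\<lambda>z. ?num z / ?den z)"
    using den by (intro continuous_on_divide c_num c_den) (metis less_irrefl)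
  then have "bounded ((\<lambda>z. ?num z / ?den z) ` ?K)"
    using K compact_continuous_image compact_imp_bounded by blast
  then obtain L where L: "\<And>z. z \<in> ?K \<Longrightarrow> norm (?num z / ?den z) \<le> L"
    unfolding bounded_iff by blast
  have L': "?num z \<le> L * ?den z" if "z \<in> ?K" for z
    using L[OF that] den[OF that] by (simp add: field_simps abs_le_iff)
  let ?U = "chart_dom c \<inter> coord c -` ball (coord c p0) r"
  have U: "open ?U"
    using continuous_on_open_vimage[OF open_chart_dom[OF c(1)], THEN iffD1, OF continuous_on_coord[OF c(1)]]
    by (metis inf_commute open_ball)
  have pU: "p0 \<in> ?U" using c r by simp
  have UW: "?U \<subseteq> ?W"
  proof
    fix p assume p: "p \<in> ?U"
    then have "coord c p \<in> ?O" using r by (auto simp del: mem_ball simp: subset_eq dist_commute mem_ball)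
    then show "p \<in> ?W" using OW(1) param_coord[OF c(1)] p by (metis IntD1)
  qed
  have "metric_norm g c' (F p) (chart_deriv F c c' (coord c p) v) \<le> L * metric_norm g c p v"
    if p: "p \<in> ?U" for p v
  proof (cases "v = 0")
    case True
    have "linear (chart_deriv F c c' (coord c p))"
      by (rule linear_chart_deriv[OF F c(1) c'(1)]) (use p UW in blast)
    then show ?thesis using True by (simp add: linear_0)
  next
    case False
    have lin: "linear (chart_deriv F c c' (coord c p))"
      by (rule linear_chart_deriv[OF F c(1) c'(1)]) (use p UW in blast)
    define w where "w = v /\<^sub>R norm v"
    have v: "v = norm v *\<^sub>R w" using False by (simp add: w_def)
    have "(coord c p, w) \<in> ?K" using p False by (auto simp: w_def)
    from L'[OF this] have *: "metric_norm g c' (F p) (chart_deriv F c c' (coord c p) w) \<le> L * metric_norm g c p w"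
      using p param_coord[OF c(1)] by simp
    have "chart_deriv F c c' (coord c p) v = norm v *\<^sub>R chart_deriv F c c' (coord c p) w"
      by (subst v) (simp add: linear_scale[OF lin])
    then have "metric_norm g c' (F p) (chart_deriv F c c' (coord c p) v)
        = norm v * metric_norm g c' (F p) (chart_deriv F c c' (coord c p) w)"
      by (simp add: metric_norm_scale)
    also have "\<dots> \<le> norm v * (L * metric_norm g c p w)"
      by (intro mult_left_mono *) simp
    also have "\<dots> = L * metric_norm g c p (norm v *\<^sub>R w)"
      unfolding metric_norm_scale by simp
    finally show ?thesis using v by simp
  qed
  then show ?thesis using U pU UW c c' by blast
qed

lemma speed_image_bound:
  assumes F: "smooth_map A F" and cpt: "compact (UNIV :: 'm set)"
  obtains L where "L > 0" "\<And>p. \<exists>c\<in>A. \<exists>c'\<in>A. p \<in> chart_dom c \<and> F p \<in> chart_dom c' \<and>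
    (\<forall>v. metric_norm g c' (F p) (chart_deriv F c c' (coord c p) v) \<le> L * metric_norm g c p v)"
proof -
  obtain U L where U: "\<And>p. open (U p)" "\<And>p. p \<in> U p" and
    L: "\<And>p. \<exists>c c'. c \<in> A \<and> c' \<in> A \<and> U p \<subseteq> chart_dom c \<inter> F -` chart_dom c' \<and>
    (\<forall>q\<in>U p. \<forall>v. metric_norm g c' (F q) (chart_deriv F c c' (coord c q) v) \<le> L p * metric_norm g c q v)"
    using speed_image_bound_local[OF F] by metis
  obtain P where P: "finite P" "UNIV \<subseteq> (\<Union>p\<in>P. U p)"
    using compactE_image[OF cpt, of UNIV U] U by (metis UNIV_I UN_I subsetI)
  define L' where "L' = 1 + (\<Sum>p\<in>P. \<bar>L p\<bar>)"
  have L': "L p \<le> L'" if "p \<in> P" for p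
    using member_le_sum[OF that, of "\<lambda>p. \<bar>L p\<bar>"] P(1) unfolding L'_def by auto
  show thesis
  proof (rule that)
    show "L' > 0" unfolding L'_def by (simp add: sum_nonneg add_pos_nonneg)
    fix q
    obtain p where p: "p \<in> P" "q \<in> U p" using P(2) by auto
    then obtain c c' where c: "c \<in> A" "c' \<in> A" "U p \<subseteq> chart_dom c \<inter> F -` chart_dom c'"
      and le: "\<And>v. metric_norm g c' (F q) (chart_deriv F c c' (coord c q) v) \<le> L p * metric_norm g c q v"
      using L[of p] by blast
    have "q \<in> chart_dom c" using c p by auto
    then have "L p * metric_norm g c q v \<le> L' * metric_norm g c q v" for v
      using L'[OF p(1)] metric_norm_nonneg[OF c(1)] by (intro mult_right_mono) auto
    then show "\<exists>c\<in>A. \<exists>c'\<in>A. q \<in> chart_dom c \<and> F q \<in> chart_dom c' \<and>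
      (\<forall>v. metric_norm g c' (F q) (chart_deriv F c c' (coord c q) v) \<le> L' * metric_norm g c q v)"
      using c p le order_trans by (metis IntD1 IntD2 subsetD vimageD)
  qed
qed

lemma piecewise_C1_curve_compose:
  assumes "smooth_map A F" "piecewise_C1_curve A \<gamma>"
  shows "piecewise_C1_curve A (F \<circ> \<gamma>)"
  using assms C1_curve_on_compose unfolding piecewise_C1_curve_def by meson

text \<open>A smooth map of a compact manifold stretches tangent vectors by a bounded factor, hence also the
  lengths of curves and the distance.\<close>

theorem riemannian_dist_lipschitz:
  assumes F: "smooth_map A F" and cpt: "compact (UNIV :: 'm set)"
  shows "\<exists>L>0. \<forall>x y. riemannian_dist A g (F x) (F y) \<le> ennreal L * riemannian_dist A g x y"
proof -
  obtain L where L: "L > 0" "\<And>p. \<exists>c\<in>A. \<exists>c'\<in>A. p \<in> chart_dom c \<and> F p \<in> chart_dom c' \<and>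
    (\<forall>v. metric_norm g c' (F p) (chart_deriv F c c' (coord c p) v) \<le> L * metric_norm g c p v)"
    using speed_image_bound[OF F cpt] by blast
  have length: "curve_length A g (F \<circ> \<gamma>) \<le> ennreal L * curve_length A g \<gamma>"
    if \<gamma>: "piecewise_C1_curve A \<gamma>" for \<gamma>
  proof -
    obtain S where S: "finite S"
      "\<forall>t\<in>{0..1} - S. \<exists>a b. a < t \<and> t < b \<and> {a..b} \<subseteq> {0..1} \<and> C1_curve_on A a b \<gamma>"
      using piecewise_C1_curve_pieces[OF \<gamma>] by blast
    have S1: "\<exists>a b. a < t \<and> t < b \<and> C1_curve_on A a b \<gamma>"
      and S2: "\<exists>a b. a < t \<and> t < b \<and> C1_curve_on A a b (F \<circ> \<gamma>)" if "t \<in> {0..1} - S" for t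
      using S(2)[THEN bspec, OF that] C1_curve_on_compose[OF F] by (meson less_trans)+
    have le: "curve_speed A g (F \<circ> \<gamma>) t \<le> L * curve_speed A g \<gamma> t" if t: "t \<in> {0..1} - S" for t
    proof -
      obtain a b where ab: "a < t" "t < b" "C1_curve_on A a b \<gamma>" using S1[OF t] by blast
      obtain c c' where c: "c \<in> A" "c' \<in> A" "\<gamma> t \<in> chart_dom c" "F (\<gamma> t) \<in> chart_dom c'"
        and bound: "\<And>v. metric_norm g c' (F (\<gamma> t)) (chart_deriv F c c' (coord c (\<gamma> t)) v) \<le> L * metric_norm g c (\<gamma> t) v"
        using L(2)[of "\<gamma> t"] by blast
      obtain v where v: "((coord c \<circ> \<gamma>) has_vector_derivative v) (at t)"
        "curve_speed A g \<gamma> t = metric_norm g c (\<gamma> t) v"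
        using curve_speed_C1[OF ab(3,1,2) c(1,3)] by blast
      have cont: "continuous_on {a<..<b} \<gamma>"
        using ab(3) unfolding C1_curve_on_def by (meson continuous_on_subset greaterThanLessThan_subseteq_atLeastAtMost_iff order_refl)
      \<comment> \<open>the speed of the image is computed in the chart in which the bound is stated\<close>
      have op: "at t within {a<..<b} = at t" using ab by (intro at_within_open) auto
      have "((coord c' \<circ> (F \<circ> \<gamma>)) has_vector_derivative chart_deriv F c c' (coord c (\<gamma> t)) v) (at t)"
        using chart_chain_rule[OF F c(1,2) cont _ c(3,4)] v(1) ab op by simp
      moreover have "continuous_on {a<..<b} (F \<circ> \<gamma>)"
        using F continuous_on_compose[OF cont] continuous_on_subset unfolding smooth_map_def by blast
      ultimately have "curve_speed A g (F \<circ> \<gamma>) t = metric_norm g c' ((F \<circ> \<gamma>) t) (chart_deriv F c c' (coord c (\<gamma> t)) v)"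
        using ab c by (intro curve_speed_eq[of "{a<..<b}"]) auto
      then show ?thesis using bound v(2) by simp
    qed
    have "curve_length A g (F \<circ> \<gamma>)
        = (\<integral>\<^sup>+t. ennreal (curve_speed A g (F \<circ> \<gamma>) t) * indicator ({0..1} - S) t \<partial>lborel)"
      by (rule curve_length_eq[OF S(1) S2])
    also have "\<dots> \<le> (\<integral>\<^sup>+t. ennreal L * (ennreal (curve_speed A g \<gamma> t) * indicator ({0..1} - S) t) \<partial>lborel)"
      using le L(1) by (intro nn_integral_mono) (auto simp: indicator_def ennreal_mult'[symmetric] intro!: ennreal_leI)
    also have "\<dots> = ennreal L * (\<integral>\<^sup>+t. ennreal (curve_speed A g \<gamma> t) * indicator ({0..1} - S) t \<partial>lborel)"
      using measurable_curve_speed[OF S(1) S1] by (intro nn_integral_cmult) simp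
    also have "\<dots> = ennreal L * curve_length A g \<gamma>"
      by (simp only: curve_length_eq[OF S(1) S1])
    finally show ?thesis .
  qed
  have "riemannian_dist A g (F x) (F y) \<le> ennreal L * riemannian_dist A g x y" for x y
  proof -
    have "riemannian_dist A g (F x) (F y) / ennreal L \<le> riemannian_dist A g x y"
      unfolding riemannian_dist_def[of A g x y]
    proof (rule INF_greatest)
      fix \<gamma> assume \<gamma>: "\<gamma> \<in> {\<gamma>. piecewise_C1_curve A \<gamma> \<and> \<gamma> 0 = x \<and> \<gamma> 1 = y}"
      have "riemannian_dist A g (F x) (F y) \<le> curve_length A g (F \<circ> \<gamma>)"
        unfolding riemannian_dist_def
        by (rule INF_lower) (use \<gamma> piecewise_C1_curve_compose[OF F] in auto)
      also have "\<dots> \<le> ennreal L * curve_length A g \<gamma>" using \<gamma> by (intro length) simp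
      finally show "riemannian_dist A g (F x) (F y) / ennreal L \<le> curve_length A g \<gamma>"
        using L(1) by (subst divide_le_posI_ennreal) (auto simp: mult.commute)
    qed
    then have "riemannian_dist A g (F x) (F y) / ennreal L * ennreal L \<le> riemannian_dist A g x y * ennreal L"
      by (rule mult_right_mono) simp
    moreover have "riemannian_dist A g (F x) (F y) / ennreal L * ennreal L = riemannian_dist A g (F x) (F y)"
      using L(1) by (simp add: ennreal_divide_times ennreal_mult_divide_eq)
    ultimately show ?thesis by (simp add: mult.commute)
  qed
  then show ?thesis using L(1) by blast
qed

end

section \<open>Local smallness and triangle inequality of the distance\<close>

context riemannian_atlas
begin

text \<open>Joining two points near \<open>p0\<close> by a straight segment in a chart gives a curve whose length is at most
  a constant times the distance of the coordinates. This makes the distance continuous with respect to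
  the manifold topology, as far as upper bounds are concerned.\<close>

theorem riemannian_dist_small:
  assumes "\<epsilon> > 0"
  shows "\<exists>U. open U \<and> p0 \<in> U \<and> (\<forall>x\<in>U. \<forall>y\<in>U. riemannian_dist A g x y < ennreal \<epsilon>)"
proof -
  obtain c where c: "c \<in> A" "p0 \<in> chart_dom c" using chart_at by blast
  let ?u0 = "coord c p0"
  have "?u0 \<in> chart_image c" using c by auto
  then obtain r where r: "r > 0" "cball ?u0 r \<subseteq> chart_image c"
    using open_chart_image[OF c(1)] open_contains_cball by blast
  let ?K = "cball ?u0 r \<times> sphere (0 :: real ^ 'd) 1"
  have K: "compact ?K" by (intro compact_Times compact_cball compact_sphere)
  have KO: "fst z \<in> chart_image c" if "z \<in> ?K" for z using that r by auto
  have "continuous_on ?K (\<lambda>z. param c (fst z))"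
    by (rule continuous_on_compose2[OF continuous_on_param[OF c(1)] continuous_on_fst[OF continuous_on_id]])
      (use KO in blast)
  then have "continuous_on ?K (\<lambda>z. metric_norm g c (param c (fst z)) (snd z))"
    by (rule continuous_on_metric_norm[OF c(1)])
      (use param_in_dom[OF c(1)] KO in \<open>auto intro!: continuous_intros\<close>)
  then have "bounded ((\<lambda>z. metric_norm g c (param c (fst z)) (snd z)) ` ?K)"
    using K compact_continuous_image compact_imp_bounded by blast
  then obtain C where C: "C > 0" "\<And>z. z \<in> ?K \<Longrightarrow> norm (metric_norm g c (param c (fst z)) (snd z)) \<le> C"
    unfolding bounded_pos by blast
  have bound: "metric_norm g c (param c u) w \<le> C * norm w" if u: "u \<in> cball ?u0 r" for u w
  proof (cases "w = 0")
    case False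
    have "metric_norm g c (param c u) (w /\<^sub>R norm w) \<le> C"
      using C(2)[of "(u, w /\<^sub>R norm w)"] u False by auto
    then have "norm w * metric_norm g c (param c u) (w /\<^sub>R norm w) \<le> norm w * C"
      by (rule mult_left_mono) simp
    moreover have "norm w * metric_norm g c (param c u) (w /\<^sub>R norm w) = metric_norm g c (param c u) w"
      using metric_norm_scale[of c "param c u" "norm w" "w /\<^sub>R norm w"] False by simp
    ultimately show ?thesis by (simp add: mult.commute)
  qed simp
  define \<delta> where "\<delta> = min r (\<epsilon> / (2 * C))"
  have \<delta>: "\<delta> > 0" "\<delta> \<le> r" "C * (2 * \<delta>) \<le> \<epsilon>"
    using r C(1) assms by (auto simp: \<delta>_def min_def field_simps)
  let ?U = "chart_dom c \<inter> coord c -` ball ?u0 \<delta>"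
  have U: "open ?U"
    using continuous_on_open_vimage[OF open_chart_dom[OF c(1)], THEN iffD1, OF continuous_on_coord[OF c(1)]]
    by (metis inf_commute open_ball)
  have "riemannian_dist A g x y < ennreal \<epsilon>" if x: "x \<in> ?U" and y: "y \<in> ?U" for x y
  proof -
    \<comment> \<open>the straight segment from \<open>x\<close> to \<open>y\<close> in coordinates\<close>
    define w where "w = coord c y - coord c x"
    define \<sigma> where "\<sigma> t = coord c x + t *\<^sub>R w" for t :: real
    define \<gamma> where "\<gamma> = param c \<circ> \<sigma>"
    have \<sigma>_ball: "\<sigma> t \<in> ball ?u0 \<delta>" if t: "t \<in> {0..1}" for t
    proof -
      have "\<sigma> t = (1 - t) *\<^sub>R coord c x + t *\<^sub>R coord c y"
        by (simp add: \<sigma>_def w_def algebra_simps)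
      then show ?thesis
        using convexD_alt[OF convex_ball, of "coord c x" ?u0 \<delta> "coord c y" t] x y t by simp
    qed
    then have \<sigma>_cball: "\<sigma> t \<in> cball ?u0 r" if t: "t \<in> {0..1}" for t
      using \<delta>(2) t by (meson ball_subset_cball cball_subset_cball_iff subset_ball subset_eq)
    then have \<sigma>_im: "\<sigma> t \<in> chart_image c" if t: "t \<in> {0..1}" for t
      using t r(2) by blast
    have ends: "\<gamma> 0 = x" "\<gamma> 1 = y"
      using x y param_coord[OF c(1)] by (auto simp: \<gamma>_def \<sigma>_def w_def)
    have \<sigma>_cont: "continuous_on {0..1} \<sigma>"
      unfolding \<sigma>_def by (intro continuous_intros)
    have \<gamma>_cont: "continuous_on {0..1} \<gamma>"
      unfolding \<gamma>_def
      by (rule continuous_on_compose[OF \<sigma>_cont continuous_on_subset[OF continuous_on_param[OF c(1)]]])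
        (use \<sigma>_im in blast)
    have \<gamma>_dom: "\<gamma> t \<in> chart_dom c" "coord c (\<gamma> t) = \<sigma> t" if "t \<in> {0..1}" for t
      using param_in_dom[OF c(1)] coord_param[OF c(1)] \<sigma>_im[OF that] by (auto simp: \<gamma>_def)
    have \<sigma>_deriv: "(\<sigma> has_vector_derivative w) (at t within T)" for t T
      unfolding \<sigma>_def has_vector_derivative_def by (auto intro!: derivative_eq_intros)
    have "C1_curve_on A 0 1 (id \<circ> \<gamma>)"
    proof (rule C1_curve_on_image[OF smooth_map_id _ \<gamma>_cont])
      fix t :: real assume "t \<in> {0..1}"
      have "((coord c \<circ> \<gamma>) has_vector_derivative w) (at s within {0..1})" if "s \<in> {0..1}" for s
        by (rule has_vector_derivative_transform[OF that _ \<sigma>_deriv]) (simp add: \<gamma>_dom(2))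
      then show "\<exists>c\<in>A. \<exists>U D. open U \<and> t \<in> U \<and> \<gamma> ` ({0..1} \<inter> U) \<subseteq> chart_dom c \<and>
          (\<forall>s\<in>{0..1} \<inter> U. ((coord c \<circ> \<gamma>) has_vector_derivative D s) (at s within {0..1})) \<and>
          continuous_on ({0..1} \<inter> U) D"
        using \<gamma>_dom(1) by (intro bexI[OF _ c(1)] exI[of _ UNIV] exI[of _ "\<lambda>_. w"]) auto
    qed simp
    then have piecewise: "piecewise_C1_curve A \<gamma>"
      by (simp add: piecewise_C1_curve_single)
    have speed: "curve_speed A g \<gamma> t \<le> C * norm w" if t: "t \<in> {0<..<1}" for t
    proof -
      have "((coord c \<circ> \<gamma>) has_vector_derivative w) (at t)"
        using \<sigma>_deriv by (rule has_vector_derivative_transform_within_open[where S = "{0<..<1}"])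
          (use t \<gamma>_dom(2) in auto)
      moreover have "continuous_on {0<..<1} \<gamma>"
        using \<gamma>_cont by (rule continuous_on_subset) auto
      ultimately have "curve_speed A g \<gamma> t = metric_norm g c (\<gamma> t) w"
        using t c \<gamma>_dom(1) by (intro curve_speed_eq[of "{0<..<1}"]) auto
      also have "\<dots> \<le> C * norm w"
        unfolding \<gamma>_def o_def by (rule bound[OF \<sigma>_cball]) (use t in auto)
      finally show ?thesis .
    qed
    have "riemannian_dist A g x y \<le> curve_length A g \<gamma>"
      unfolding riemannian_dist_def by (rule INF_lower) (use piecewise ends in auto)
    also have "\<dots> \<le> (\<integral>\<^sup>+t\<in>{0..1::real}. ennreal (C * norm w) \<partial>lborel)"
      unfolding curve_length_def
    proof (rule nn_integral_mono_AE)
      have "AE t in lborel. t \<notin> {0, 1 :: real}"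
        by (intro AE_not_in finite_imp_null_set_lborel) simp
      then show "AE t in lborel. ennreal (curve_speed A g \<gamma> t) * indicator {0..1} t
          \<le> ennreal (C * norm w) * indicator {0..1} t"
        by eventually_elim (use speed in \<open>auto simp: indicator_def intro!: ennreal_leI\<close>)
    qed
    also have "\<dots> = ennreal (C * norm w)"
      by (simp add: nn_integral_cmult_indicator)
    also have "\<dots> < ennreal \<epsilon>"
    proof (rule ennreal_lessI[OF assms])
      have "norm w \<le> dist ?u0 (coord c x) + dist ?u0 (coord c y)"
        unfolding w_def dist_norm[symmetric] by (metis dist_commute dist_triangle)
      also have "\<dots> < 2 * \<delta>" using x y by simp
      finally have "C * norm w < C * (2 * \<delta>)" using C(1) by simp
      then show "C * norm w < \<epsilon>" using \<delta>(3) by simp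
    qed
    finally show ?thesis .
  qed
  then show ?thesis using U c \<delta>(1) by (intro exI[of _ ?U]) auto
qed

lemma curve_speed_reparam:
  assumes \<gamma>: "C1_curve_on A a b \<gamma>" and "m > 0" and ab: "a = m * a' + q" "b = m * b' + q"
    and eq: "\<And>t. t \<in> {a'..b'} \<Longrightarrow> \<gamma>' t = \<gamma> (m * t + q)" and t: "a' < t" "t < b'"
  shows "curve_speed A g \<gamma>' t = m * curve_speed A g \<gamma> (m * t + q)"
proof -
  have mem: "m * s + q \<in> {a<..<b}" if "s \<in> {a'<..<b'}" for s
    using that \<open>m > 0\<close> unfolding ab by auto
  let ?t = "m * t + q"
  obtain c where c: "c \<in> A" "\<gamma> ?t \<in> chart_dom c" using chart_at by blast
  obtain v where v: "((coord c \<circ> \<gamma>) has_vector_derivative v) (at ?t)"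
    "curve_speed A g \<gamma> ?t = metric_norm g c (\<gamma> ?t) v"
    using curve_speed_C1[OF \<gamma> _ _ c] mem[of t] t by auto
  have "((\<lambda>t. m * t + q) has_vector_derivative m) (at t)"
    unfolding has_vector_derivative_def by (auto intro!: derivative_eq_intros)
  then have "(((coord c \<circ> \<gamma>) \<circ> (\<lambda>t. m * t + q)) has_vector_derivative m *\<^sub>R v) (at t)"
    using vector_diff_chain_at v(1) by blast
  then have v': "((coord c \<circ> \<gamma>') has_vector_derivative m *\<^sub>R v) (at t)"
    by (rule has_vector_derivative_transform_within_open[where S = "{a'<..<b'}"]) (use t eq in auto)
  have "C1_curve_on A a' b' \<gamma>'"
    by (rule C1_curve_on_reparam[OF \<gamma> \<open>m > 0\<close> ab eq])
  then have "continuous_on {a'<..<b'} \<gamma>'"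
    unfolding C1_curve_on_def by (meson continuous_on_subset greaterThanLessThan_subseteq_atLeastAtMost_iff order_refl)
  then have "curve_speed A g \<gamma>' t = metric_norm g c (\<gamma>' t) (m *\<^sub>R v)"
    using t c eq[of t] by (intro curve_speed_eq[OF _ _ _ c(1) _ v', of "{a'<..<b'}"]) auto
  then show ?thesis using v(2) eq[of t] t \<open>m > 0\<close> by (simp add: metric_norm_scale)
qed

text \<open>Two curves are concatenated, each one run through at double speed. The integrals are compared
  almost everywhere, off the images of the division points and the junction \<open>1/2\<close>.\<close>

theorem riemannian_dist_triangle:
  "riemannian_dist A g x z \<le> riemannian_dist A g x y + riemannian_dist A g y z"
proof -
  have main: "riemannian_dist A g x z \<le> curve_length A g \<gamma>1 + curve_length A g \<gamma>2"
    if p1: "piecewise_C1_curve A \<gamma>1" and p2: "piecewise_C1_curve A \<gamma>2"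
      and ends: "\<gamma>1 0 = x" "\<gamma>1 1 = y" "\<gamma>2 0 = y" "\<gamma>2 1 = z" for \<gamma>1 \<gamma>2
  proof -
    define \<gamma> where "\<gamma> t = (if t \<le> 1/2 then \<gamma>1 (2 * t) else \<gamma>2 (2 * t - 1))" for t
    have \<gamma>1: "\<gamma> t = \<gamma>1 (2 * t + 0)" if "t \<le> 1/2" for t using that by (simp add: \<gamma>_def)
    have \<gamma>2: "\<gamma> t = \<gamma>2 (2 * t + (-1))" if "1/2 \<le> t" for t
    proof (cases "t = 1/2")
      case True
      then have "t \<le> 1/2" "2 * t = 1" "2 * t + (-1) = 0" by auto
      then show ?thesis using ends by (simp add: \<gamma>_def)
    next
      case False
      then show ?thesis using that by (simp add: \<gamma>_def)
    qed
    have C1_left: "C1_curve_on A a' b' \<gamma>" if "C1_curve_on A (2 * a' + 0) (2 * b' + 0) \<gamma>1" "b' \<le> 1/2" for a' b'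
      by (rule C1_curve_on_reparam[OF that(1) _ refl refl]) (use that \<gamma>1 in auto)
    have C1_right: "C1_curve_on A a' b' \<gamma>" if "C1_curve_on A (2 * a' + (-1)) (2 * b' + (-1)) \<gamma>2" "1/2 \<le> a'" for a' b'
      by (rule C1_curve_on_reparam[OF that(1) _ refl refl]) (use that \<gamma>2 in auto)
    have pw: "piecewise_C1_curve A \<gamma>"
    proof -
      obtain S1 where S1: "finite S1" "{0, 1} \<subseteq> S1" "S1 \<subseteq> {0..1}"
        "\<forall>a\<in>S1. \<forall>b\<in>S1. a < b \<and> {a<..<b} \<inter> S1 = {} \<longrightarrow> C1_curve_on A a b \<gamma>1"
        using p1 unfolding piecewise_C1_curve_def by blast
      have C1_1: "C1_curve_on A a b \<gamma>1" if "a \<in> S1" "b \<in> S1" "a < b" "{a<..<b} \<inter> S1 = {}" for a b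
        using S1(4) that by blast
      obtain S2 where S2: "finite S2" "{0, 1} \<subseteq> S2" "S2 \<subseteq> {0..1}"
        "\<forall>a\<in>S2. \<forall>b\<in>S2. a < b \<and> {a<..<b} \<inter> S2 = {} \<longrightarrow> C1_curve_on A a b \<gamma>2"
        using p2 unfolding piecewise_C1_curve_def by blast
      have C1_2: "C1_curve_on A a b \<gamma>2" if "a \<in> S2" "b \<in> S2" "a < b" "{a<..<b} \<inter> S2 = {}" for a b
        using S2(4) that by blast
      define S where "S = {t. (t \<le> 1/2 \<and> 2 * t \<in> S1) \<or> (1/2 \<le> t \<and> 2 * t - 1 \<in> S2)}"
      have "S \<subseteq> (\<lambda>s. s / 2) ` S1 \<union> (\<lambda>s. (s + 1) / 2) ` S2"
      proof
        fix t assume "t \<in> S"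
        then consider "2 * t \<in> S1" | "2 * t - 1 \<in> S2" unfolding S_def by blast
        then show "t \<in> (\<lambda>s. s / 2) ` S1 \<union> (\<lambda>s. (s + 1) / 2) ` S2"
          by cases (auto intro: image_eqI[of t _ "2 * t"] image_eqI[of t _ "2 * t - 1"])
      qed
      then have S_fin: "finite S" using S1(1) S2(1) finite_subset by blast
      have S_01: "{0, 1} \<subseteq> S" using S1(2) S2(2) by (auto simp: S_def)
      have S_sub: "S \<subseteq> {0..1}"
      proof
        fix t assume "t \<in> S"
        then consider "t \<le> 1/2" "2 * t \<in> {0..1}" | "1/2 \<le> t" "2 * t - 1 \<in> {0..1}"
          using S1(3) S2(3) unfolding S_def by blast
        then show "t \<in> {0..1}" by cases auto
      qed
      have "C1_curve_on A a b \<gamma>" if ab: "a \<in> S" "b \<in> S" "a < b" "{a<..<b} \<inter> S = {}" for a b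
      proof -
        have left: "2 * t + 0 \<in> S1" if "t \<in> S" "t \<le> 1/2" for t
        proof (cases "t = 1/2")
          case True
          then have "2 * t + 0 = 1" by simp
          then show ?thesis using S1(2) by simp
        qed (use that in \<open>auto simp: S_def\<close>)
        have right: "2 * t + (-1) \<in> S2" if "t \<in> S" "1/2 \<le> t" for t
        proof (cases "t = 1/2")
          case True
          then have "2 * t + (-1) = 0" by simp
          then show ?thesis using S2(2) by simp
        qed (use that in \<open>auto simp: S_def\<close>)
        \<comment> \<open>the junction is a division point, so a piece lies entirely in one half\<close>
        have "1/2 \<in> S" using S1(2) by (auto simp: S_def)
        then have "1/2 \<notin> {a<..<b}" using ab(4) by blast
        then consider "b \<le> 1/2" | "1/2 \<le> a" by fastforce
        then show ?thesis
        proof cases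
          case 1
          show ?thesis
          proof (rule C1_left[OF C1_1 1])
            show "2 * a + 0 \<in> S1" "2 * b + 0 \<in> S1"
              using left[OF ab(1)] left[OF ab(2)] ab(3) 1 by auto
            show "{2 * a + 0<..<2 * b + 0} \<inter> S1 = {}"
            proof (rule ccontr)
              assume "\<not> ?thesis"
              then obtain s where s: "s \<in> S1" "2 * a < s" "s < 2 * b" by auto
              then have "s / 2 \<in> {a<..<b} \<inter> S" using 1 by (auto simp: S_def)
              then show False using ab(4) by blast
            qed
          qed (use ab in auto)
        next
          case 2
          show ?thesis
          proof (rule C1_right[OF C1_2 2])
            show "2 * a + (-1) \<in> S2" "2 * b + (-1) \<in> S2"
              using right[OF ab(1)] right[OF ab(2)] ab(3) 2 by auto
            show "{2 * a + (-1)<..<2 * b + (-1)} \<inter> S2 = {}"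
            proof (rule ccontr)
              assume "\<not> ?thesis"
              then obtain s where s: "s \<in> S2" "2 * a - 1 < s" "s < 2 * b - 1" by auto
              then have "(s + 1) / 2 \<in> {a<..<b} \<inter> S" using 2 by (auto simp: S_def field_simps)
              then show False using ab(4) by blast
            qed
          qed (use ab in auto)
        qed
      qed
      then show ?thesis
        unfolding piecewise_C1_curve_def
        by (intro exI[of _ S] conjI ballI impI S_fin S_01 S_sub) (elim conjE)
    qed
    obtain S1 where S1: "finite S1"
      "\<forall>t\<in>{0..1} - S1. \<exists>a b. a < t \<and> t < b \<and> {a..b} \<subseteq> {0..1} \<and> C1_curve_on A a b \<gamma>1"
      using piecewise_C1_curve_pieces[OF p1] by blast
    obtain S2 where S2: "finite S2"
      "\<forall>t\<in>{0..1} - S2. \<exists>a b. a < t \<and> t < b \<and> {a..b} \<subseteq> {0..1} \<and> C1_curve_on A a b \<gamma>2"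
      using piecewise_C1_curve_pieces[OF p2] by blast
    have pieces1: "\<exists>a b. a < t \<and> t < b \<and> C1_curve_on A a b \<gamma>1" if "t \<in> {0..1} - S1" for t
      using S1(2)[THEN bspec, OF that] by blast
    have pieces2: "\<exists>a b. a < t \<and> t < b \<and> C1_curve_on A a b \<gamma>2" if "t \<in> {0..1} - S2" for t
      using S2(2)[THEN bspec, OF that] by blast
    have speed1: "curve_speed A g \<gamma> t = 2 * curve_speed A g \<gamma>1 (2 * t + 0)"
      if t: "2 * t \<in> {0..1} - S1" for t
    proof -
      obtain a b where ab: "a < 2 * t" "2 * t < b" "{a..b} \<subseteq> {0..1}" "C1_curve_on A a b \<gamma>1"
        using S1(2)[THEN bspec, OF t] by blast
      have "b \<le> 1" using ab by (auto simp: subset_eq)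
      show ?thesis
        by (rule curve_speed_reparam[OF ab(4), of 2 "a / 2" 0 "b / 2"]) (use ab \<open>b \<le> 1\<close> \<gamma>1 in auto)
    qed
    have speed2: "curve_speed A g \<gamma> t = 2 * curve_speed A g \<gamma>2 (2 * t + (-1))"
      if t: "2 * t + (-1) \<in> {0..1} - S2" for t
    proof -
      obtain a b where ab: "a < 2 * t + (-1)" "2 * t + (-1) < b" "{a..b} \<subseteq> {0..1}" "C1_curve_on A a b \<gamma>2"
        using S2(2)[THEN bspec, OF t] by blast
      have "a \<ge> 0" using ab by (auto simp: subset_eq)
      show ?thesis
        by (rule curve_speed_reparam[OF ab(4), of 2 "(a + 1) / 2" "-1" "(b + 1) / 2"])
          (use ab \<open>a \<ge> 0\<close> \<gamma>2 in \<open>auto simp: field_simps\<close>)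
    qed
    define h1 where "h1 t = ennreal (curve_speed A g \<gamma>1 t) * indicator ({0..1} - S1) t" for t
    define h2 where "h2 t = ennreal (curve_speed A g \<gamma>2 t) * indicator ({0..1} - S2) t" for t
    have [measurable]: "h1 \<in> borel_measurable borel" "h2 \<in> borel_measurable borel"
      using measurable_curve_speed[OF S1(1) pieces1] measurable_curve_speed[OF S2(1) pieces2]
      unfolding h1_def[abs_def] h2_def[abs_def] by auto
    let ?E = "(\<lambda>s. s / 2) ` S1 \<union> (\<lambda>s. (s + 1) / 2) ` S2 \<union> {1/2}"
    have "riemannian_dist A g x z \<le> curve_length A g \<gamma>"
      unfolding riemannian_dist_def by (rule INF_lower) (use pw ends in \<open>auto simp: \<gamma>_def\<close>)
    also have "\<dots> \<le> (\<integral>\<^sup>+t. 2 * h1 (0 + 2 * t) + 2 * h2 ((-1) + 2 * t) \<partial>lborel)"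
      unfolding curve_length_def
    proof (rule nn_integral_mono_AE)
      have "AE t in lborel. t \<notin> ?E"
        by (intro AE_not_in finite_imp_null_set_lborel) (use S1 S2 in auto)
      then show "AE t in lborel. ennreal (curve_speed A g \<gamma> t) * indicator {0..1} t
          \<le> 2 * h1 (0 + 2 * t) + 2 * h2 ((-1) + 2 * t)"
      proof eventually_elim
        case (elim t)
        have e: "2 * t \<notin> S1" "2 * t - 1 \<notin> S2" "t \<noteq> 1/2"
          using elim image_eqI[of t "\<lambda>s. s / 2" "2 * t" S1] image_eqI[of t "\<lambda>s. (s + 1) / 2" "2 * t - 1" S2]
          by auto
        consider "t \<notin> {0..1}" | "0 \<le> t" "t < 1/2" | "1/2 < t" "t \<le> 1" using e(3) by fastforce
        then show ?case
        proof cases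
          case 2
          then have "2 * t \<in> {0..1} - S1" using e by auto
          then have "ennreal (curve_speed A g \<gamma> t) = 2 * h1 (0 + 2 * t)"
            using speed1[of t] by (simp add: h1_def ennreal_mult')
          then show ?thesis using 2 by simp
        next
          case 3
          then have "2 * t + (-1) \<in> {0..1} - S2" using e by auto
          then have "ennreal (curve_speed A g \<gamma> t) = 2 * h2 ((-1) + 2 * t)"
            using speed2[of t] by (simp add: h2_def ennreal_mult' add.commute)
          then show ?thesis using 3 by simp
        qed simp
      qed
    qed
    also have "\<dots> = 2 * (\<integral>\<^sup>+t. h1 (0 + 2 * t) \<partial>lborel) + 2 * (\<integral>\<^sup>+t. h2 ((-1) + 2 * t) \<partial>lborel)"
      by (simp add: nn_integral_add nn_integral_cmult)
    also have "\<dots> = (\<integral>\<^sup>+t. h1 t \<partial>lborel) + (\<integral>\<^sup>+t. h2 t \<partial>lborel)"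
      using nn_integral_real_affine[of h1 2 0] nn_integral_real_affine[of h2 2 "-1"] by simp
    also have "\<dots> = curve_length A g \<gamma>1 + curve_length A g \<gamma>2"
      unfolding h1_def h2_def
      by (simp only: curve_length_eq[OF S1(1) pieces1, symmetric] curve_length_eq[OF S2(1) pieces2, symmetric])
    finally show ?thesis .
  qed
  show ?thesis
  proof (rule ennreal_le_epsilon)
    fix e :: real
    assume fin: "riemannian_dist A g x y + riemannian_dist A g y z < top" and e: "0 < e"
    have e2: "ennreal (e / 2) > 0" using e by simp
    have "riemannian_dist A g x y < riemannian_dist A g x y + ennreal (e / 2)"
      using fin e2 ennreal_add_left_cancel_less[of "riemannian_dist A g x y" 0 "ennreal (e / 2)"] by auto
    then obtain \<gamma>1 where \<gamma>1: "piecewise_C1_curve A \<gamma>1" "\<gamma>1 0 = x" "\<gamma>1 1 = y"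
      "curve_length A g \<gamma>1 < riemannian_dist A g x y + ennreal (e / 2)"
      unfolding riemannian_dist_def[of A g x y] INF_less_iff by blast
    have "riemannian_dist A g y z < riemannian_dist A g y z + ennreal (e / 2)"
      using fin e2 ennreal_add_left_cancel_less[of "riemannian_dist A g y z" 0 "ennreal (e / 2)"] by auto
    then obtain \<gamma>2 where \<gamma>2: "piecewise_C1_curve A \<gamma>2" "\<gamma>2 0 = y" "\<gamma>2 1 = z"
      "curve_length A g \<gamma>2 < riemannian_dist A g y z + ennreal (e / 2)"
      unfolding riemannian_dist_def[of A g y z] INF_less_iff by blast
    have "riemannian_dist A g x z \<le> curve_length A g \<gamma>1 + curve_length A g \<gamma>2"
      by (rule main) (use \<gamma>1 \<gamma>2 in auto)
    also have "\<dots> \<le> (riemannian_dist A g x y + ennreal (e / 2)) + (riemannian_dist A g y z + ennreal (e / 2))"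
      using \<gamma>1(4) \<gamma>2(4) by (intro add_mono) auto
    also have "\<dots> = riemannian_dist A g x y + riemannian_dist A g y z + (ennreal (e / 2) + ennreal (e / 2))"
      by (simp add: ac_simps)
    also have "ennreal (e / 2) + ennreal (e / 2) = ennreal e"
      using e by (simp flip: ennreal_plus)
    finally show "riemannian_dist A g x z \<le> riemannian_dist A g x y + riemannian_dist A g y z + ennreal e" .
  qed
qed

end

section \<open>Category, order statistics and logarithms\<close>

text \<open>Baire's theorem with neighbourhoods of the points of one fixed dense set in place of dense open sets;
  their interiors are open and dense.\<close>

lemma contains_dense_gdelta_INT:
  fixes P :: "'m::t2_space set"
  assumes cpt: "compact (UNIV :: 'm set)" and P: "closure P = UNIV"
    and V: "\<And>n::nat. P \<subseteq> interior (V n)"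
  shows "contains_dense_gdelta (\<Inter>n. V n)"
proof -
  let ?G = "\<Inter>(range (\<lambda>n. interior (V n)))"
  have K: "compact_space (euclidean :: 'm topology)"
    using cpt by (simp add: compact_space_def)
  have "Hausdorff_space (euclidean :: 'm topology)"
    unfolding Hausdorff_space_def
  proof (intro allI impI)
    fix x y :: 'm assume "x \<in> topspace euclidean \<and> y \<in> topspace euclidean \<and> x \<noteq> y"
    then have "x \<noteq> y" by simp
    from hausdorff[OF this] obtain U V where "open U" "open V" "x \<in> U" "y \<in> V" "U \<inter> V = {}"
      by (elim exE conjE)
    then show "\<exists>U V. openin euclidean U \<and> openin euclidean V \<and> x \<in> U \<and> y \<in> V \<and> disjnt U V"
      by (intro exI[of _ U] exI[of _ V]) (simp add: disjnt_def)
  qed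
  then have "regular_space (euclidean :: 'm topology)"
    using compact_Hausdorff_imp_regular_space[OF K] by simp
  then have cat: "completely_metrizable_space (euclidean :: 'm topology)
      \<or> locally_compact_space (euclidean :: 'm topology) \<and> regular_space (euclidean :: 'm topology)"
    using compact_imp_locally_compact_space[OF K] by simp
  have "(euclidean :: 'm topology) closure_of ?G = topspace euclidean"
  proof (rule Baire_category[OF cat])
    fix T assume "T \<in> range (\<lambda>n. interior (V n))"
    then obtain n where T: "T = interior (V n)" by blast
    have "closure T = UNIV" using closure_mono[OF V[of n]] P T by auto
    then show "openin euclidean T \<and> euclidean closure_of T = topspace euclidean" using T by simp
  qed simp
  then have "closure ?G = UNIV" by simp
  moreover have "gdelta ?G" by (rule gdelta.intros) simp
  moreover have "?G \<subseteq> (\<Inter>n. V n)" using interior_subset by blast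
  ultimately show ?thesis unfolding contains_dense_gdelta_def by blast
qed

lemma sorted_nth_less_iff:
  fixes xs :: "'a::linorder list"
  assumes "sorted xs" "i < length xs"
  shows "xs ! i < t \<longleftrightarrow> i < length (filter (\<lambda>a. a < t) xs)"
  using assms
proof (induction xs arbitrary: i)
  case (Cons a xs)
  show ?case
  proof (cases "a < t")
    case True
    show ?thesis
    proof (cases i)
      case (Suc j)
      then show ?thesis using Cons.IH[of j] Cons.prems True by simp
    qed (simp add: True)
  next
    case False
    then have *: "\<not> b < t" if "b \<in> set (a # xs)" for b using Cons.prems(1) that by auto
    then have "filter (\<lambda>a. a < t) (a # xs) = []" by (simp add: filter_empty_conv)
    moreover have "\<not> (a # xs) ! i < t" using * nth_mem[OF Cons.prems(2)] by blast
    ultimately show ?thesis by simp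
  qed
qed simp

text \<open>In a sorted list the entries below \<open>t\<close> form an initial segment. Counting replaces order statistics from
  here on, since counts are visibly monotone in \<open>n\<close> and \<open>t\<close> and easy to follow when the target moves.\<close>

lemma nth_closest_less_iff:
  assumes "1 \<le> r" "r \<le> n"
  shows "nth_closest dst f r n x y < t \<longleftrightarrow> r \<le> card {k\<in>{1..n}. dst x ((f ^^ k) y) < t}"
proof -
  let ?h = "\<lambda>k. dst x ((f ^^ k) y)"
  have "nth_closest dst f r n x y < t
      \<longleftrightarrow> r - 1 < length (filter (\<lambda>a. a < t) (sort (map ?h [1..<Suc n])))"
    unfolding nth_closest_def using assms by (intro sorted_nth_less_iff) auto
  also have "length (filter (\<lambda>a. a < t) (sort (map ?h [1..<Suc n]))) = length (filter (\<lambda>k. ?h k < t) [1..<Suc n])"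
    by (simp add: filter_sort filter_map o_def del: upt_Suc)
  also have "\<dots> = card (set (filter (\<lambda>k. ?h k < t) [1..<Suc n]))"
    by (intro distinct_card[symmetric] distinct_filter distinct_upt)
  also have "set (filter (\<lambda>k. ?h k < t) [1..<Suc n]) = {k\<in>{1..n}. ?h k < t}" by auto
  finally have "nth_closest dst f r n x y < t \<longleftrightarrow> r - 1 < card {k\<in>{1..n}. ?h k < t}" .
  moreover have "r - 1 < m \<longleftrightarrow> r \<le> m" for m using assms(1) by arith
  ultimately show ?thesis by (simp only:)
qed

lemma nth_closest_mono:
  assumes "1 \<le> r" "r \<le> r'" "r' \<le> n"
  shows "nth_closest dst f r n x y \<le> nth_closest dst f r' n x y"
  unfolding nth_closest_def using assms by (intro sorted_nth_mono) auto

lemma nth_closest_less_later: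
  assumes "nth_closest dst f r m x y < t" "1 \<le> r" "r \<le> m" "m \<le> n"
  shows "nth_closest dst f r n x y < t"
proof -
  have "r \<le> card {k\<in>{1..m}. dst x ((f ^^ k) y) < t}"
    using assms(1) unfolding nth_closest_less_iff[OF assms(2,3)] .
  also have "\<dots> \<le> card {k\<in>{1..n}. dst x ((f ^^ k) y) < t}"
    using assms(4) by (intro card_mono) auto
  finally show ?thesis
    unfolding nth_closest_less_iff[OF assms(2) order_trans[OF assms(3,4)]] .
qed

lemma abs_ln_ge:
  assumes "a < ennreal (exp (- c))" "c \<ge> 0"
  shows "ereal c \<le> abs_ln a"
proof (cases "a = 0")
  case False
  have fin: "a \<noteq> \<infinity>" using assms(1) by auto
  obtain x where x: "a = ennreal x" "x > 0"
    using fin False by (cases a) (auto simp: le_less)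
  then have "x < exp (- c)" using assms(1) by (simp add: ennreal_less_iff)
  then have "ln x < - c" using x by (metis exp_gt_zero ln_exp ln_less_cancel_iff)
  then show ?thesis using x False fin by (auto simp: abs_ln_def)
qed (simp add: abs_ln_def)

text \<open>A large value of \<open>\<bar>ln a\<bar>\<close> may come from a large \<open>a\<close> as well as from a small one. An a priori upper
  bound on \<open>a\<close> excludes the former.\<close>

lemma less_exp_if_abs_ln:
  assumes "ereal c < abs_ln a" "a < ennreal (exp c)"
  shows "a < ennreal (exp (- c))"
proof (cases "a = 0")
  case False
  have fin: "a \<noteq> \<infinity>" using assms(2) by auto
  obtain x where x: "a = ennreal x" "x > 0"
    using fin False by (cases a) (auto simp: le_less)
  then have "x < exp c" using assms(2) by (simp add: ennreal_less_iff)
  then have "ln x < c" using x by (metis exp_gt_zero ln_exp ln_less_cancel_iff)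
  moreover have "c < \<bar>ln x\<bar>" using assms(1) x False fin by (auto simp: abs_ln_def)
  ultimately have "ln x < - c" by auto
  then have "x < exp (- c)" using x by (metis exp_less_mono exp_ln)
  then show ?thesis using x by (simp add: ennreal_less_iff)
qed simp

text \<open>\<open>abs_ln\<close> is antitone only on distances below 1; larger distances are absorbed by the constant \<open>K\<close>.\<close>

lemma abs_ln_le_max:
  assumes "a \<le> b" "b < ennreal (exp K)" "K \<ge> 0"
  shows "abs_ln b \<le> max (abs_ln a) (ereal K)"
proof (cases "a = 0")
  case False
  have fin: "b \<noteq> \<infinity>" "a \<noteq> \<infinity>" using assms by (auto simp: top.extremum_unique)
  obtain x where x: "a = ennreal x" "x > 0"
    using fin False by (cases a) (auto simp: le_less)
  obtain y where y: "b = ennreal y" "y > 0"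
    using fin False assms(1) by (cases b) (auto simp: le_less)
  have "x \<le> y" using x y assms(1) by (simp add: ennreal_le_iff)
  then have "ln x \<le> ln y" using x y by simp
  moreover have "y < exp K" using y assms(2) by (simp add: ennreal_less_iff)
  then have "ln y < K" using y by (metis exp_gt_zero ln_exp ln_less_cancel_iff)
  ultimately have "\<bar>ln y\<bar> \<le> max \<bar>ln x\<bar> K" by auto
  moreover have "abs_ln a = ereal \<bar>ln x\<bar>" "abs_ln b = ereal \<bar>ln y\<bar>"
    using x y by (auto simp: abs_ln_def ennreal_eq_0_iff)
  ultimately show ?thesis by (metis ereal_less_eq(3) ereal_max)
qed (simp add: abs_ln_def)

lemma le_limsup_if_frequently:
  fixes X :: "nat \<Rightarrow> ereal"
  assumes "\<And>N. \<exists>n\<ge>N. C \<le> X n"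
  shows "C \<le> limsup X"
proof (rule ccontr)
  assume "\<not> C \<le> limsup X"
  then have "\<forall>\<^sub>F n in sequentially. X n < C" by (intro Limsup_lessD) simp
  then show False using assms unfolding eventually_sequentially by (meson not_le)
qed

lemma frequently_if_less_limsup:
  fixes X :: "nat \<Rightarrow> ereal"
  assumes "C < limsup X"
  shows "\<exists>n\<ge>N. C < X n"
proof (rule ccontr)
  assume "\<not> ?thesis"
  then have "\<forall>\<^sub>F n in sequentially. X n \<le> C"
    unfolding eventually_sequentially by (meson not_le)
  then have "limsup X \<le> C" by (rule Limsup_bounded)
  then show False using assms by simp
qed

text \<open>The quotient in the logarithm law in dimension \<open>D\<close>; the argument \<open>a\<close> stands for the absolute value of the
  logarithm of a closest distance.\<close>

definition excess :: "real \<Rightarrow> ereal \<Rightarrow> nat \<Rightarrow> ereal" where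
  "excess D a n = (a - ereal (1 / D * ln (real n))) / ereal (ln (ln (real n)))"

lemma ln_ln_pos: "n \<ge> 3 \<Longrightarrow> ln (ln (real n)) > 0"
proof -
  assume "n \<ge> 3"
  then have "exp 1 < real n" using exp_le e_less_272 by linarith
  then have "1 < ln (real n)" by (metis exp_gt_zero less_trans ln_exp ln_less_cancel_iff)
  then show ?thesis by simp
qed

lemma excess_ge:
  assumes "n \<ge> 3" "ereal (1 / D * ln (real n) + c * ln (ln (real n))) \<le> a"
  shows "ereal c \<le> excess D a n"
  using assms(2) ln_ln_pos[OF assms(1)]
  by (cases a) (auto simp: excess_def field_simps)

lemma excess_gt:
  assumes "n \<ge> 3" "ereal c < excess D a n"
  shows "ereal (1 / D * ln (real n) + c * ln (ln (real n))) < a"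
  using assms(2) ln_ln_pos[OF assms(1)]
  by (cases a) (auto simp: excess_def field_simps)

lemma excess_mono:
  assumes "n \<ge> 3" "a \<le> b"
  shows "excess D a n \<le> excess D b n"
  unfolding excess_def using ln_ln_pos[OF assms(1)] assms(2)
  by (intro ereal_divide_right_mono ereal_minus_mono) auto

text \<open>The distance \<open>n powr (- 1 / D) * ln n powr (- \<beta>)\<close>; for \<open>n \<ge> 3\<close> its excess is \<open>\<beta>\<close>.\<close>

definition threshold :: "real \<Rightarrow> real \<Rightarrow> nat \<Rightarrow> real" where
  "threshold D \<beta> n = exp (- (1 / D * ln (real n) + \<beta> * ln (ln (real n))))"

text \<open>Lowering the exponent of the logarithm by any amount makes up for a constant factor in the distance
  and a bounded delay in time.\<close>

lemma threshold_shift: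
  assumes "0 < D" "\<beta> < c" "0 < \<Lambda>"
  shows "\<forall>\<^sub>F n in sequentially. \<Lambda> * threshold D c n \<le> threshold D \<beta> (n + q)"
proof -
  define e where "e = c - \<beta>"
  have e: "e > 0" "c = \<beta> + e" using assms by (auto simp: e_def)
  have 1: "(\<lambda>n. ln (real (n + q)) - ln (real n)) \<longlonglongrightarrow> 0" by real_asymp
  have 2: "(\<lambda>n. ln (ln (real (n + q))) - ln (ln (real n))) \<longlonglongrightarrow> 0" by real_asymp
  have "(\<lambda>n. 1 / D * (ln (real (n + q)) - ln (real n)) + \<beta> * (ln (ln (real (n + q))) - ln (ln (real n))))
      \<longlonglongrightarrow> 1 / D * 0 + \<beta> * 0"
    by (intro tendsto_intros 1 2)
  then have "\<forall>\<^sub>F n in sequentially. 1 / D * (ln (real (n + q)) - ln (real n))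
      + \<beta> * (ln (ln (real (n + q))) - ln (ln (real n))) < 1"
    by (intro order_tendstoD(2)[of _ 0]) auto
  moreover have "filterlim (\<lambda>n. e * ln (ln (real n))) at_top sequentially"
    using e(1) by real_asymp
  then have "\<forall>\<^sub>F n in sequentially. e * ln (ln (real n)) \<ge> ln \<Lambda> + 1"
    by (simp add: filterlim_at_top)
  ultimately show ?thesis
  proof eventually_elim
    case (elim n)
    have "ln \<Lambda> - (1 / D * ln (real n) + c * ln (ln (real n)))
      \<le> - (1 / D * ln (real (n + q)) + \<beta> * ln (ln (real (n + q))))"
      using elim unfolding e(2) by (simp add: algebra_simps)
    then have "exp (ln \<Lambda> - (1 / D * ln (real n) + c * ln (ln (real n)))) \<le> threshold D \<beta> (n + q)"
      unfolding threshold_def by simp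
    then show ?case
      by (simp only: threshold_def exp_diff exp_ln[OF assms(3)] exp_minus divide_inverse)
  qed
qed

section \<open>Generic recurrence in systems with dense periodic points\<close>

text \<open>A counting form of \<open>nth_closest dst f r n x y < t\<close>. It is meaningful for all \<open>r\<close> and \<open>n\<close>, being false
  for \<open>r > n\<close>, where there is no \<open>r\<close>-th distance.\<close>

definition hits :: "('m \<Rightarrow> 'm \<Rightarrow> ennreal) \<Rightarrow> ('m \<Rightarrow> 'm) \<Rightarrow> real \<Rightarrow> nat \<Rightarrow> nat \<Rightarrow> 'm \<Rightarrow> 'm \<Rightarrow> bool" where
  "hits dst f t r n x y \<longleftrightarrow> r \<le> card {k\<in>{1..n}. dst x ((f ^^ k) y) < ennreal t}"

lemma hits_le: "hits dst f t r n x y \<Longrightarrow> r \<le> n"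
proof -
  have "card {k\<in>{1..n}. dst x ((f ^^ k) y) < ennreal t} \<le> card {1..n}"
    by (intro card_mono) auto
  then show "hits dst f t r n x y \<Longrightarrow> r \<le> n" unfolding hits_def by simp
qed

lemma hits_mono:
  assumes "hits dst f t r n x y" "t \<le> t'"
  shows "hits dst f t' r n x y"
proof -
  have "card {k\<in>{1..n}. dst x ((f ^^ k) y) < ennreal t} \<le> card {k\<in>{1..n}. dst x ((f ^^ k) y) < ennreal t'}"
    using less_le_trans[OF _ ennreal_leI[OF assms(2)]] by (intro card_mono) auto
  then show ?thesis using assms(1) unfolding hits_def by simp
qed

lemma nth_closest_less_if_hits:
  assumes "hits dst f t R n x y" "1 \<le> r" "r \<le> R"
  shows "nth_closest dst f r n x y < ennreal t"
proof -
  have "nth_closest dst f R n x y < ennreal t"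
    using assms hits_le[OF assms(1)] by (subst nth_closest_less_iff) (auto simp: hits_def)
  then show ?thesis
    using nth_closest_mono[OF assms(2,3) hits_le[OF assms(1)]] by (rule le_less_trans[rotated])
qed

lemma hits_iff_subset:
  "hits dst f t r n x y \<longleftrightarrow> (\<exists>K\<subseteq>{1..n}. card K = r \<and> (\<forall>k\<in>K. dst x ((f ^^ k) y) < ennreal t))"
proof
  assume "hits dst f t r n x y"
  then obtain K where "K \<subseteq> {k\<in>{1..n}. dst x ((f ^^ k) y) < ennreal t}" "card K = r"
    unfolding hits_def by (meson obtain_subset_with_card_n)
  then show "\<exists>K\<subseteq>{1..n}. card K = r \<and> (\<forall>k\<in>K. dst x ((f ^^ k) y) < ennreal t)" by blast
next
  assume "\<exists>K\<subseteq>{1..n}. card K = r \<and> (\<forall>k\<in>K. dst x ((f ^^ k) y) < ennreal t)"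
  then show "hits dst f t r n x y"
    unfolding hits_def by (auto intro!: card_mono)
qed

lemma funpow_periodic:
  assumes "(f ^^ p) x = x"
  shows "(f ^^ (j * p)) x = x"
  by (induction j) (simp_all add: assms funpow_add)

text \<open>A continuous map with dense periodic points, together with the three upper bounds that enter of the
  Riemannian distance. They allow the value \<open>\<infinity>\<close>, which occurs between points of different components.\<close>

locale periodically_dense_system =
  fixes dst :: "'m::t2_space \<Rightarrow> 'm \<Rightarrow> ennreal" and f :: "'m \<Rightarrow> 'm"
  assumes compact: "compact (UNIV :: 'm set)"
    and triangle: "dst x z \<le> dst x y + dst y z"
    and small: "\<epsilon> > 0 \<Longrightarrow> \<exists>U. open U \<and> p \<in> U \<and> (\<forall>x\<in>U. \<forall>y\<in>U. dst x y < ennreal \<epsilon>)"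
    and lipschitz: "\<exists>L>0. \<forall>x y. dst (f x) (f y) \<le> ennreal L * dst x y"
    and continuous: "continuous_on UNIV f"
    and dense: "closure (periodic_points f) = UNIV"
begin

lemma continuous_funpow: "continuous_on UNIV (f ^^ k)"
proof (induction k)
  case (Suc k)
  then show ?case
    using continuous_on_compose[OF Suc] continuous_on_subset[OF continuous] by (simp add: o_def) blast
qed (simp add: continuous_on_id)

lemma open_less: "open {z. dst x z < ennreal t}"
proof (subst open_subopen, intro ballI)
  fix z assume "z \<in> {z. dst x z < ennreal t}"
  then have lt: "dst x z < ennreal t" by simp
  then obtain a where a: "a \<ge> 0" "dst x z = ennreal a"
    by (cases "dst x z") auto
  then have at: "a < t" using lt by (simp add: ennreal_less_iff)
  obtain U where U: "open U" "z \<in> U" "\<forall>x\<in>U. \<forall>y\<in>U. dst x y < ennreal (t - a)"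
    using small[of "t - a" z] at by auto
  have "dst x z' < ennreal t" if "z' \<in> U" for z'
  proof -
    have "dst x z' \<le> ennreal a + dst z z'" using triangle[of x z' z] a by simp
    also have "\<dots> < ennreal a + ennreal (t - a)"
      using U that by (simp add: ennreal_add_left_cancel_less)
    also have "\<dots> = ennreal t" using a at by (simp flip: ennreal_plus)
    finally show ?thesis .
  qed
  then show "\<exists>T. open T \<and> z \<in> T \<and> T \<subseteq> {z. dst x z < ennreal t}" using U by blast
qed

lemma open_hits: "open {y. hits dst f t r n x y}"
proof -
  have "open {y. dst x ((f ^^ k) y) < ennreal t}" for k
    using open_vimage[OF open_less[of x t] continuous_funpow[of k]] by (simp add: vimage_def)
  then have "open (\<Union>K\<in>{K. K \<subseteq> {1..n} \<and> card K = r}. \<Inter>k\<in>K. {y. dst x ((f ^^ k) y) < ennreal t})"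
    by (intro open_UN open_INT ballI) (auto intro: finite_subset)
  also have "(\<Union>K\<in>{K. K \<subseteq> {1..n} \<and> card K = r}. \<Inter>k\<in>K. {y. dst x ((f ^^ k) y) < ennreal t})
      = {y. hits dst f t r n x y}"
    unfolding hits_iff_subset by auto
  finally show ?thesis .
qed

text \<open>The amount \<open>\<eta>\<close> by which the target may move does not depend on \<open>y\<close>, so a whole set of orbits keeps
  hitting it.\<close>

lemma hits_perturb:
  assumes "hits dst f t r n x y" "dst x' x < ennreal \<eta>" "t + \<eta> \<le> t'" "t \<ge> 0" "\<eta> \<ge> 0"
  shows "hits dst f t' r n x' y"
proof -
  have "dst x' z < ennreal t'" if "dst x z < ennreal t" for z
  proof -
    have "dst x' z \<le> dst x' x + dst x z" by (rule triangle)
    also have "\<dots> < ennreal \<eta> + ennreal t" using assms(2) that by (rule add_strict_mono)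
    also have "\<dots> \<le> ennreal t'" using assms by (simp flip: ennreal_plus add: ennreal_leI add.commute)
    finally show ?thesis .
  qed
  then have "card {k\<in>{1..n}. dst x ((f ^^ k) y) < ennreal t} \<le> card {k\<in>{1..n}. dst x' ((f ^^ k) y) < ennreal t'}"
    by (intro card_mono) auto
  then show ?thesis using assms(1) unfolding hits_def by simp
qed

text \<open>A point of period \<open>p\<close> returns exactly to itself \<open>R\<close> times up to time \<open>R * p\<close>, hence all nearby points
  return as closely as prescribed. The set \<open>V R\<close> demands this for \<open>R\<close> returns at the scale
  \<open>exp (- R * \<zeta> n)\<close>; the same \<open>R\<close> bounds \<open>n\<close> from below, so that membership in all \<open>V R\<close> yields
  infinitely many times.\<close>

theorem generic_self_recurrence:
  assumes \<zeta>: "\<And>n::nat. \<zeta> n \<ge> (1::nat)"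
  shows "contains_dense_gdelta
    {x. \<forall>r\<ge>1. limsup (\<lambda>n. abs_ln (nth_closest dst f r n x x) / ereal (real (\<zeta> n))) = \<infinity>}"
proof -
  define V where "V R = {x. \<exists>n\<ge>R. hits dst f (exp (- real R * real (\<zeta> n))) R n x x}" for R
  have "periodic_points f \<subseteq> interior (V R)" for R
  proof
    fix x assume "x \<in> periodic_points f"
    then obtain p where p: "p \<ge> 1" "(f ^^ p) x = x" unfolding periodic_points_def by blast
    define n where "n = R * p"
    define t where "t = exp (- real R * real (\<zeta> n))"
    obtain U where U: "open U" "x \<in> U" "\<forall>x\<in>U. \<forall>y\<in>U. dst x y < ennreal t"
      using small[of t x] by (auto simp: t_def)
    let ?W = "U \<inter> (\<Inter>j\<in>{1..R}. (f ^^ (j * p)) -` U)"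
    have "open ?W" by (intro open_Int U open_INT ballI open_vimage continuous_funpow) auto
    moreover have "x \<in> ?W" using U funpow_periodic[OF p(2)] by auto
    moreover have "?W \<subseteq> V R"
    proof
      fix z assume z: "z \<in> ?W"
      have "hits dst f t R n z z"
        unfolding hits_iff_subset
      proof (intro exI[of _ "(\<lambda>j. j * p) ` {1..R}"] conjI ballI)
        show "card ((\<lambda>j. j * p) ` {1..R}) = R"
          using p by (subst card_image) (auto simp: inj_on_def)
      qed (use z U p in \<open>auto simp: n_def\<close>)
      moreover have "n \<ge> R" using p by (simp add: n_def)
      ultimately show "z \<in> V R" unfolding V_def t_def by blast
    qed
    ultimately show "x \<in> interior (V R)" by (meson interiorI)
  qed
  then have "contains_dense_gdelta (\<Inter>R. V R)"
    by (intro contains_dense_gdelta_INT[OF compact dense])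
  moreover have "limsup (\<lambda>n. abs_ln (nth_closest dst f r n x x) / ereal (real (\<zeta> n))) = \<infinity>"
    if x: "x \<in> (\<Inter>R. V R)" and r: "r \<ge> 1" for x r
  proof -
    have "ereal (real B) \<le> limsup (\<lambda>n. abs_ln (nth_closest dst f r n x x) / ereal (real (\<zeta> n)))" for B
    proof (rule le_limsup_if_frequently)
      fix N
      define R where "R = max N (max B r)"
      obtain n where n: "n \<ge> R" "hits dst f (exp (- real R * real (\<zeta> n))) R n x x"
        using x unfolding V_def by blast
      have "nth_closest dst f r n x x < ennreal (exp (- (real R * real (\<zeta> n))))"
        using nth_closest_less_if_hits[OF n(2) r] by (simp add: R_def)
      then have "ereal (real R * real (\<zeta> n)) \<le> abs_ln (nth_closest dst f r n x x)"
        by (rule abs_ln_ge) simp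
      moreover have "real B * real (\<zeta> n) \<le> real R * real (\<zeta> n)"
        by (intro mult_right_mono) (auto simp: R_def)
      ultimately have "ereal (real B * real (\<zeta> n)) \<le> abs_ln (nth_closest dst f r n x x)"
        by (meson ereal_less_eq(3) order_trans)
      then have "ereal (real B) \<le> abs_ln (nth_closest dst f r n x x) / ereal (real (\<zeta> n))"
        using \<zeta>[of n] by (subst ereal_le_divide_pos) (auto simp: mult.commute)
      then show "\<exists>n\<ge>N. ereal (real B) \<le> abs_ln (nth_closest dst f r n x x) / ereal (real (\<zeta> n))"
        using n(1) by (auto simp: R_def)
    qed
    then show ?thesis
      by (intro ereal_top) (meson ereal_less_eq(3) order_trans real_arch_simple)
  qed
  ultimately show ?thesis
    unfolding contains_dense_gdelta_def by (smt (verit, best) mem_Collect_eq subset_iff)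
qed

lemma lipschitz_funpow:
  obtains L where "L \<ge> 1" "\<And>k x y. dst ((f ^^ k) x) ((f ^^ k) y) \<le> ennreal (L ^ k) * dst x y"
proof -
  obtain L0 where L0: "\<And>x y. dst (f x) (f y) \<le> ennreal L0 * dst x y" using lipschitz by blast
  define L where "L = max 1 L0"
  have L: "dst (f x) (f y) \<le> ennreal L * dst x y" for x y
    using L0 by (rule order_trans) (auto intro!: mult_right_mono ennreal_leI simp: L_def)
  have "dst ((f ^^ k) x) ((f ^^ k) y) \<le> ennreal (L ^ k) * dst x y" for k x y
  proof (induction k)
    case (Suc k)
    have "dst ((f ^^ Suc k) x) ((f ^^ Suc k) y) \<le> ennreal L * dst ((f ^^ k) x) ((f ^^ k) y)"
      using L by simp
    also have "\<dots> \<le> ennreal L * (ennreal (L ^ k) * dst x y)" by (intro mult_left_mono Suc) simp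
    finally show ?case by (simp add: ennreal_mult' L_def mult.assoc)
  qed simp
  then show thesis using that[of L] by (simp add: L_def)
qed

text \<open>Once an orbit is close to a point of period \<open>p\<close>, it comes back every \<open>p\<close> steps, and each return costs
  at most the Lipschitz factor of \<open>f\<close> to the power \<open>p\<close>.\<close>

lemma hits_at_periodic:
  assumes p: "p \<ge> 1" "(f ^^ p) x = x"
  shows "\<exists>\<Lambda>>0. \<forall>t n y. nth_closest dst f 1 n x y < ennreal t \<longrightarrow> n \<ge> 1 \<longrightarrow>
    hits dst f (\<Lambda> * t) r (n + r * p) x y"
proof -
  obtain L where L: "L \<ge> 1" "\<And>k x y. dst ((f ^^ k) x) ((f ^^ k) y) \<le> ennreal (L ^ k) * dst x y"
    using lipschitz_funpow by blast
  have "hits dst f (L ^ (r * p) * t) r (n + r * p) x y"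
    if close: "nth_closest dst f 1 n x y < ennreal t" and n: "n \<ge> 1" for t n y
  proof -
    have "1 \<le> card {k\<in>{1..n}. dst x ((f ^^ k) y) < ennreal t}"
      using nth_closest_less_iff[of 1 n dst f x y "ennreal t"] n close by simp
    then have "{k\<in>{1..n}. dst x ((f ^^ k) y) < ennreal t} \<noteq> {}"
      by (metis card.empty not_one_le_zero)
    then obtain k where k: "k \<in> {1..n}" "dst x ((f ^^ k) y) < ennreal t" by blast
    show ?thesis
      unfolding hits_iff_subset
    proof (intro exI[of _ "(\<lambda>j. j * p + k) ` {..<r}"] conjI ballI)
      show "card ((\<lambda>j. j * p + k) ` {..<r}) = r"
        using p by (subst card_image) (auto simp: inj_on_def)
      show "(\<lambda>j. j * p + k) ` {..<r} \<subseteq> {1..n + r * p}"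
        using k(1) by (auto intro!: add_le_mono simp: add.commute[of n])
      fix i assume "i \<in> (\<lambda>j. j * p + k) ` {..<r}"
      then obtain j where j: "j < r" "i = j * p + k" by auto
      have "dst x ((f ^^ i) y) = dst ((f ^^ (j * p)) x) ((f ^^ (j * p)) ((f ^^ k) y))"
        using funpow_periodic[OF p(2), of j] j by (simp add: funpow_add)
      also have "\<dots> \<le> ennreal (L ^ (j * p)) * dst x ((f ^^ k) y)" by (rule L)
      also have "\<dots> \<le> ennreal (L ^ (r * p)) * dst x ((f ^^ k) y)"
        using L(1) j by (intro mult_right_mono ennreal_leI power_increasing) auto
      also have "\<dots> < ennreal (L ^ (r * p)) * ennreal t"
        using k(2) L(1) by (intro ennreal_mult_strict_left_mono) auto
      also have "\<dots> = ennreal (L ^ (r * p) * t)" using L(1) by (simp add: ennreal_mult')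
      finally show "dst x ((f ^^ i) y) < ennreal (L ^ (r * p) * t)" .
    qed
  qed
  then show ?thesis using L(1) by (intro exI[of _ "L ^ (r * p)"]) auto
qed

text \<open>At a periodic point, repeated approaches are as good as single ones: the constant \<open>\<Lambda>\<close> and the delay
  \<open>r * p\<close> are paid for by passing from an exponent \<open>c\<close> between \<open>\<beta>\<close> and \<open>1 / D\<close> to \<open>\<beta>\<close>.\<close>

lemma frequently_hits_at_periodic:
  assumes D: "D > 0" and p: "p \<ge> 1" "(f ^^ p) x = x"
    and lim: "limsup (\<lambda>n. excess D (abs_ln (nth_closest dst f 1 n x y)) n) = ereal (1 / D)"
    and \<beta>: "0 \<le> \<beta>" "\<beta> < 1 / D"
  shows "\<exists>n\<ge>N. hits dst f (threshold D \<beta> n) r n x y"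
proof -
  define c where "c = (\<beta> + 1 / D) / 2"
  have c: "\<beta> < c" "c < 1 / D" "c > 0" using \<beta> by (auto simp: c_def)
  obtain \<Lambda> where \<Lambda>: "\<Lambda> > 0" "\<And>t n y. nth_closest dst f 1 n x y < ennreal t \<Longrightarrow> n \<ge> 1 \<Longrightarrow>
    hits dst f (\<Lambda> * t) r (n + r * p) x y"
    using hits_at_periodic[OF p, of r] by blast
  \<comment> \<open>an upper bound for the distances: if they were all infinite, so would be the limit superior\<close>
  have "\<exists>m\<ge>1. nth_closest dst f 1 m x y \<noteq> \<infinity>"
  proof (rule ccontr)
    assume inf: "\<not> ?thesis"
    have "\<infinity> \<le> limsup (\<lambda>n. excess D (abs_ln (nth_closest dst f 1 n x y)) n)"
    proof (rule le_limsup_if_frequently)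
      fix N
      have "nth_closest dst f 1 (max N 3) x y = \<infinity>" using inf by auto
      then have "excess D (abs_ln (nth_closest dst f 1 (max N 3) x y)) (max N 3) = \<infinity>"
        using ln_ln_pos[of "max N 3"] unfolding excess_def abs_ln_def by simp
      then show "\<exists>n\<ge>N. \<infinity> \<le> excess D (abs_ln (nth_closest dst f 1 n x y)) n"
        by (intro exI[of _ "max N 3"]) simp
    qed
    then show False using lim by simp
  qed
  then obtain m where m: "m \<ge> 1" "nth_closest dst f 1 m x y \<noteq> \<infinity>" by blast
  then obtain a where a: "a \<ge> 0" "nth_closest dst f 1 m x y = ennreal a"
    by (cases "nth_closest dst f 1 m x y") auto
  define C where "C = a + 1"
  have C: "C > 0" "nth_closest dst f 1 m x y < ennreal C"
    using a by (auto simp: C_def ennreal_less_iff)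
  have "filterlim (\<lambda>n. 1 / D * ln (real n)) at_top sequentially"
    using D by real_asymp
  then have "\<forall>\<^sub>F n in sequentially. 1 / D * ln (real n) \<ge> ln C"
    by (simp add: filterlim_at_top)
  moreover have "\<forall>\<^sub>F n in sequentially. \<Lambda> * threshold D c n \<le> threshold D \<beta> (n + r * p)"
    by (rule threshold_shift[OF D c(1) \<Lambda>(1)])
  ultimately have "\<forall>\<^sub>F n in sequentially. 1 / D * ln (real n) \<ge> ln C \<and>
      \<Lambda> * threshold D c n \<le> threshold D \<beta> (n + r * p)"
    by eventually_elim simp
  then obtain N0 where N0: "\<And>n. n \<ge> N0 \<Longrightarrow> 1 / D * ln (real n) \<ge> ln C \<and>
      \<Lambda> * threshold D c n \<le> threshold D \<beta> (n + r * p)"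
    unfolding eventually_sequentially by blast
  have "ereal c < limsup (\<lambda>n. excess D (abs_ln (nth_closest dst f 1 n x y)) n)"
    using c(2) lim by simp
  then obtain n where n: "n \<ge> max (max N N0) (max m 3)"
    "ereal c < excess D (abs_ln (nth_closest dst f 1 n x y)) n"
    using frequently_if_less_limsup by blast
  define E where "E = 1 / D * ln (real n) + c * ln (ln (real n))"
  have n3: "n \<ge> 3" using n(1) by simp
  have "ereal E < abs_ln (nth_closest dst f 1 n x y)"
    unfolding E_def by (rule excess_gt[OF n3 n(2)])
  moreover have "nth_closest dst f 1 n x y < ennreal (exp E)"
  proof -
    have "nth_closest dst f 1 n x y < ennreal C"
      by (rule nth_closest_less_later[OF C(2)]) (use m n in auto)
    moreover have "ln C \<le> E"
      using N0[of n] n(1) mult_pos_pos[OF c(3) ln_ln_pos[OF n3]] unfolding E_def by simp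
    then have "C \<le> exp E" using C(1) by (metis exp_le_cancel_iff exp_ln)
    ultimately show ?thesis by (meson ennreal_leI less_le_trans)
  qed
  ultimately have "nth_closest dst f 1 n x y < ennreal (exp (- E))"
    by (rule less_exp_if_abs_ln)
  then have "hits dst f (\<Lambda> * threshold D c n) r (n + r * p) x y"
    using n3 unfolding E_def threshold_def by (intro \<Lambda>(2)) auto
  then have "hits dst f (threshold D \<beta> (n + r * p)) r (n + r * p) x y"
    by (rule hits_mono) (use N0 n in simp)
  then show ?thesis using n(1) by (intro exI[of _ "n + r * p"]) auto
qed

text \<open>The lower bound is the generic part. At a periodic point almost every \<open>y\<close> hits the targets with exponent
  \<open>\<beta> (Suc R)\<close> at some time; up to a large time \<open>N\<close> this is true for a set of \<open>y\<close> of measure close to 1.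
  Only finitely many targets are involved, so they stay inside the larger targets with exponent \<open>\<beta> R\<close>
  when \<open>x\<close> moves a little. Since \<open>\<beta> R\<close> tends to \<open>1 / D\<close> and the measures to 1, a point in all \<open>V R\<close> has
  the lower bound for almost every \<open>y\<close>, and for all \<open>r\<close> at once because \<open>R\<close> also counts the hits.
  The upper bound is inherited from \<open>r = 1\<close>: the \<open>r\<close>-th distance is at least the first one, and it is
  eventually bounded because of the hits.\<close>

theorem generic_multiple_recurrence:
  assumes D: "D > 0" and sets: "sets \<mu> = sets borel" and prob: "prob_space \<mu>"
    and single: "\<And>x. AE y in \<mu>. limsup (\<lambda>n. excess D (abs_ln (nth_closest dst f 1 n x y)) n) = ereal (1 / D)"
  shows "contains_dense_gdelta
    {x. AE y in \<mu>. \<forall>r\<ge>1. limsup (\<lambda>n. excess D (abs_ln (nth_closest dst f r n x y)) n) = ereal (1 / D)}"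
proof -
  interpret prob_space \<mu> by (rule prob)
  define \<beta> where "\<beta> R = (1 - 1 / (real R + 1)) / D" for R
  have \<beta>: "0 \<le> \<beta> R" "\<beta> R < 1 / D" "\<beta> R < \<beta> (Suc R)" for R
  proof -
    have "1 / (real R + 1) \<le> 1" "0 < 1 / (real R + 1)" "1 / (real (Suc R) + 1) < 1 / (real R + 1)"
      by (simp_all add: frac_less2)
    then show "0 \<le> \<beta> R" "\<beta> R < 1 / D" "\<beta> R < \<beta> (Suc R)"
      using D unfolding \<beta>_def by (auto intro!: divide_strict_right_mono)
  qed
  \<comment> \<open>times start at \<open>R + 3\<close>, so that \<open>ln (ln n)\<close> is positive\<close>
  define E where "E R N x = {y. \<exists>n\<in>{R + 3..N}. hits dst f (threshold D (\<beta> R) n) R n x y}" for R N x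
  define E' where "E' R N x = {y. \<exists>n\<in>{R + 3..N}. hits dst f (threshold D (\<beta> (Suc R)) n) R n x y}" for R N x
  have space: "space \<mu> = UNIV" using sets by (metis sets_eq_imp_space_eq space_borel)
  have open_ex: "open {y. \<exists>n\<in>I. hits dst f (t n) R n x y}" for I t R x
  proof -
    have "{y. \<exists>n\<in>I. hits dst f (t n) R n x y} = (\<Union>n\<in>I. {y. hits dst f (t n) R n x y})" by auto
    then show ?thesis by (simp add: open_UN open_hits)
  qed
  then have meas_ex: "{y. \<exists>n\<in>I. hits dst f (t n) R n x y} \<in> events" for I t R x
    using sets by simp
  define V where "V R = {x. \<exists>N. 1 - 1 / (real R + 1) < prob (E R N x)}" for R
  have "periodic_points f \<subseteq> interior (V R)" for R
  proof
    fix x assume "x \<in> periodic_points f"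
    then obtain p where p: "p \<ge> 1" "(f ^^ p) x = x" unfolding periodic_points_def by blast
    have "AE y in \<mu>. y \<in> (\<Union>N. E' R N x)"
      using single[of x]
    proof eventually_elim
      case (elim y)
      obtain n where "n \<ge> R + 3" "hits dst f (threshold D (\<beta> (Suc R)) n) R n x y"
        using frequently_hits_at_periodic[OF D p elim \<beta>(1,2)] by blast
      then show ?case unfolding E'_def by (intro UN_I[of n]) auto
    qed
    moreover have meas: "E' R N x \<in> events" for N unfolding E'_def by (rule meas_ex)
    ultimately have "prob (\<Union>N. E' R N x) = 1"
      by (intro prob_eq_1[THEN iffD2]) auto
    moreover have "(\<lambda>N. prob (E' R N x)) \<longlonglongrightarrow> prob (\<Union>N. E' R N x)"
      by (rule finite_Lim_measure_incseq) (use meas in \<open>auto simp: incseq_def E'_def\<close>)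
    ultimately have "\<forall>\<^sub>F N in sequentially. 1 - 1 / (real R + 1) < prob (E' R N x)"
      by (intro order_tendstoD(1)[of _ 1]) auto
    then obtain N where N: "1 - 1 / (real R + 1) < prob (E' R N x)"
      unfolding eventually_sequentially by blast
    \<comment> \<open>\<open>x\<close> may move by the smallest difference of the finitely many target radii\<close>
    let ?gap = "\<lambda>n. threshold D (\<beta> R) n - threshold D (\<beta> (Suc R)) n"
    have gap: "?gap n > 0" if "n \<in> {R + 3..N}" for n
      using ln_ln_pos[of n] that \<beta>(3)[of R] by (simp add: threshold_def)
    define \<eta> where "\<eta> = Min (insert 1 (?gap ` {R + 3..N}))"
    have \<eta>: "\<eta> > 0" using gap by (auto simp: \<eta>_def)
    have \<eta>_le: "threshold D (\<beta> (Suc R)) n + \<eta> \<le> threshold D (\<beta> R) n" if "n \<in> {R + 3..N}" for n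
    proof -
      have "\<eta> \<le> ?gap n" unfolding \<eta>_def using that by (intro Min_le) auto
      then show ?thesis by simp
    qed
    obtain U where U: "open U" "x \<in> U" "\<forall>x\<in>U. \<forall>y\<in>U. dst x y < ennreal \<eta>"
      using small[OF \<eta>, of x] by blast
    have "U \<subseteq> V R"
    proof
      fix x' assume x': "x' \<in> U"
      have "E' R N x \<subseteq> E R N x'"
      proof
        fix y assume "y \<in> E' R N x"
        then obtain n where n: "n \<in> {R + 3..N}" "hits dst f (threshold D (\<beta> (Suc R)) n) R n x y"
          unfolding E'_def by blast
        have "hits dst f (threshold D (\<beta> R) n) R n x' y"
          by (rule hits_perturb[OF n(2) _ \<eta>_le[OF n(1)]])
            (use U x' \<eta> in \<open>auto simp: threshold_def\<close>)
        then show "y \<in> E R N x'" using n(1) unfolding E_def by blast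
      qed
      moreover have "E R N x' \<in> events" unfolding E_def by (rule meas_ex)
      ultimately have "prob (E' R N x) \<le> prob (E R N x')" by (rule finite_measure_mono)
      then show "x' \<in> V R" using N unfolding V_def by (auto intro: less_le_trans)
    qed
    then show "x \<in> interior (V R)" using U by (meson interiorI)
  qed
  then have "contains_dense_gdelta (\<Inter>R. V R)"
    by (intro contains_dense_gdelta_INT[OF compact dense])
  moreover have "AE y in \<mu>. \<forall>r\<ge>1. limsup (\<lambda>n. excess D (abs_ln (nth_closest dst f r n x y)) n) = ereal (1 / D)"
    if x: "x \<in> (\<Inter>R. V R)" for x
  proof -
    define F where "F R = {y. \<exists>n\<in>{R + 3..}. hits dst f (threshold D (\<beta> R) n) R n x y}" for R
    have F: "F R \<in> events" for R unfolding F_def by (rule meas_ex)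
    have F_prob: "prob (F R) > 1 - 1 / (real R + 1)" for R
    proof -
      obtain N where N: "1 - 1 / (real R + 1) < prob (E R N x)" using x unfolding V_def by blast
      have "prob (E R N x) \<le> prob (F R)"
        by (rule finite_measure_mono[OF _ F]) (auto simp: E_def F_def)
      then show ?thesis using N by simp
    qed
    \<comment> \<open>a limit superior of events whose probabilities tend to 1 has probability 1\<close>
    have "AE y in \<mu>. y \<in> (\<Union>R\<in>{m..}. F R)" for m
    proof -
      have "prob (\<Union>R\<in>{m..}. F R) \<ge> 1"
      proof (rule LIMSEQ_le_const2)
        show "(\<lambda>R. 1 - 1 / (real R + 1)) \<longlonglongrightarrow> 1" by real_asymp
        have "prob (F R) \<le> prob (\<Union>R\<in>{m..}. F R)" if "R \<ge> m" for R
          by (rule finite_measure_mono) (use that F in auto)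
        then show "\<exists>N. \<forall>R\<ge>N. 1 - 1 / (real R + 1) \<le> prob (\<Union>R\<in>{m..}. F R)"
          using F_prob by (meson less_imp_le order_trans)
      qed
      then have "prob (\<Union>R\<in>{m..}. F R) = 1" using prob_le_1 by (simp add: antisym)
      then show ?thesis using F by (subst (asm) prob_eq_1) auto
    qed
    then have "AE y in \<mu>. \<forall>m. \<exists>R\<ge>m. y \<in> F R"
      unfolding AE_all_countable by (simp add: Bex_def)
    then show ?thesis
      using single[of x]
    proof eventually_elim
      case (elim y)
      have frequent: "\<exists>R\<ge>m. \<exists>n\<ge>R + 3. hits dst f (threshold D (\<beta> R) n) R n x y" for m
        using elim(1) unfolding F_def mem_Collect_eq Bex_def atLeast_iff by blast
      show ?case
      proof (intro allI impI antisym)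
        fix r :: nat assume r: "r \<ge> 1"
        let ?X = "\<lambda>n. excess D (abs_ln (nth_closest dst f r n x y)) n"
        show "ereal (1 / D) \<le> limsup ?X"
        proof (rule dense_le)
          fix z assume z: "z < ereal (1 / D)"
          have "(\<lambda>R. 1 - 1 / (real R + 1)) \<longlonglongrightarrow> 1" by real_asymp
          then have "\<beta> \<longlonglongrightarrow> 1 / D"
            unfolding \<beta>_def using D by (intro tendsto_divide tendsto_const) auto
          then have "(\<lambda>R. ereal (\<beta> R)) \<longlonglongrightarrow> ereal (1 / D)" by simp
          then have "\<forall>\<^sub>F R in sequentially. z < ereal (\<beta> R)"
            using z by (rule order_tendstoD(1))
          then obtain R0 where R0: "\<And>R. R \<ge> R0 \<Longrightarrow> z < ereal (\<beta> R)"
            unfolding eventually_sequentially by blast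
          show "z \<le> limsup ?X"
          proof (rule le_limsup_if_frequently)
            fix N
            obtain R n where Rn: "R \<ge> max (max R0 r) N" "n \<ge> R + 3"
              "hits dst f (threshold D (\<beta> R) n) R n x y"
              using frequent by blast
            let ?e = "1 / D * ln (real n) + \<beta> R * ln (ln (real n))"
            have "nth_closest dst f r n x y < ennreal (exp (- ?e))"
              using nth_closest_less_if_hits[OF Rn(3) r] Rn(1) by (simp add: threshold_def)
            moreover have "?e \<ge> 0"
              using D \<beta>(1)[of R] ln_ln_pos[of n] Rn(2) by (intro add_nonneg_nonneg mult_nonneg_nonneg) auto
            ultimately have "ereal ?e \<le> abs_ln (nth_closest dst f r n x y)"
              by (rule abs_ln_ge)
            then have "ereal (\<beta> R) \<le> ?X n" using Rn(2) by (intro excess_ge) auto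
            moreover have "z < ereal (\<beta> R)" using R0 Rn(1) by simp
            ultimately have "z \<le> ?X n" by simp
            then show "\<exists>n\<ge>N. z \<le> ?X n" using Rn(1,2) by (intro exI[of _ n]) auto
          qed
        qed
        show "limsup ?X \<le> ereal (1 / D)"
          unfolding Limsup_le_iff
        proof (intro allI impI)
          fix z assume z: "ereal (1 / D) < z"
          obtain R m where Rm: "R \<ge> r" "m \<ge> R + 3" "hits dst f (threshold D (\<beta> R) m) R m x y"
            using frequent by blast
          define C where "C = threshold D (\<beta> R) m"
          have C: "C > 0" "nth_closest dst f r m x y < ennreal C"
            using nth_closest_less_if_hits[OF Rm(3) r Rm(1)] by (auto simp: C_def threshold_def)
          define K where "K = max 0 (ln C)"
          have K: "K \<ge> 0" "C \<le> exp K" using C(1) by (auto simp: K_def max_def)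
          have "\<forall>\<^sub>F n in sequentially. excess D (abs_ln (nth_closest dst f 1 n x y)) n < z"
            using elim(2) z by (intro Limsup_lessD) simp
          moreover have "filterlim (\<lambda>n. 1 / D * ln (real n)) at_top sequentially"
            using D by real_asymp
          then have "\<forall>\<^sub>F n in sequentially. 1 / D * ln (real n) \<ge> K"
            by (simp add: filterlim_at_top)
          ultimately show "\<forall>\<^sub>F n in sequentially. ?X n < z"
            using eventually_ge_at_top[of "max m 3"]
          proof eventually_elim
            case (elim n)
            have n: "n \<ge> m" "n \<ge> 3" using elim by auto
            have "nth_closest dst f r n x y < ennreal C"
              by (rule nth_closest_less_later[OF C(2) r _ n(1)]) (use Rm in auto)
            then have "nth_closest dst f r n x y < ennreal (exp K)"
              using K(2) by (meson ennreal_leI less_le_trans)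
            moreover have "nth_closest dst f 1 n x y \<le> nth_closest dst f r n x y"
              by (rule nth_closest_mono) (use r n Rm in auto)
            ultimately have le: "abs_ln (nth_closest dst f r n x y)
                \<le> max (abs_ln (nth_closest dst f 1 n x y)) (ereal K)"
              using abs_ln_le_max K(1) by blast
            have "excess D (ereal K) n \<le> 0"
              using elim(2) ln_ln_pos[OF n(2)] by (simp add: excess_def divide_nonpos_pos)
            also have "0 < z" using z D by (meson ereal_less(2) less_trans zero_less_divide_1_iff)
            finally have "excess D (ereal K) n < z" .
            moreover have "excess D (abs_ln (nth_closest dst f 1 n x y)) n < z" by (rule elim(1))
            ultimately show "?X n < z"
              using excess_mono[OF n(2) le, of D] by (cases "abs_ln (nth_closest dst f 1 n x y) \<le> ereal K")
                (auto simp: max_def split: if_splits)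
          qed
        qed
      qed
    qed
  qed
  ultimately show ?thesis
    unfolding contains_dense_gdelta_def by (smt (verit, best) mem_Collect_eq subset_iff)
qed

end

section \<open>Recurrence on Riemannian manifolds\<close>

theorem theorem4p6:
  fixes A :: "('m::t2_space, 'd::finite) chart set"
    and g :: "('m, 'd) metric_tensor"
    and f :: "'m \<Rightarrow> 'm"
    and \<mu> :: "'m measure"
  assumes "compact (UNIV :: 'm set)"
    and "smooth_atlas A"
    and "riemannian_metric A g"
    and "smooth_diffeo A f"
    and "smooth_measure A g \<mu>"
    and "prob_space \<mu>"
    and "distr \<mu> \<mu> f = \<mu>"
    and "closure (periodic_points f) = UNIV"
  shows "((\<forall>x. AE y in \<mu>.
            limsup (\<lambda>n. (abs_ln (nth_closest (riemannian_dist A g) f 1 n x y)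
                          - ereal (1 / real CARD('d) * ln (real n))) / ereal (ln (ln (real n))))
              = ereal (1 / real CARD('d))) \<longrightarrow>
          contains_dense_gdelta
            {x. AE y in \<mu>. \<forall>r\<ge>1.
              limsup (\<lambda>n. (abs_ln (nth_closest (riemannian_dist A g) f r n x y)
                            - ereal (1 / real CARD('d) * ln (real n))) / ereal (ln (ln (real n))))
                = ereal (1 / real CARD('d))})
       \<and> (\<forall>\<zeta> :: nat \<Rightarrow> nat. (\<forall>n. \<zeta> n \<ge> 1) \<longrightarrow>
          contains_dense_gdelta
            {x. \<forall>r\<ge>1.
              limsup (\<lambda>n. abs_ln (nth_closest (riemannian_dist A g) f r n x x) / ereal (real (\<zeta> n)))
                = \<infinity>})"
proof -
  have f: "smooth_map A f" using assms(4) unfolding smooth_diffeo_def by blast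
  interpret riemannian_atlas A g by unfold_locales (rule assms(2,3))+
  interpret periodically_dense_system "riemannian_dist A g" f
  proof
    show "continuous_on UNIV f" using f unfolding smooth_map_def by blast
  qed (fact assms(1,8) riemannian_dist_triangle riemannian_dist_small
      riemannian_dist_lipschitz[OF f assms(1)])+
  have sets: "sets \<mu> = sets borel"
    using assms(5) unfolding smooth_measure_def riemannian_volume_def by auto
  have "real CARD('d) > 0" by simp
  note multiple = generic_multiple_recurrence[OF this sets assms(6), unfolded excess_def]
  show ?thesis
  proof (intro conjI impI allI)
    assume "\<forall>x. AE y in \<mu>.
            limsup (\<lambda>n. (abs_ln (nth_closest (riemannian_dist A g) f 1 n x y)
                          - ereal (1 / real CARD('d) * ln (real n))) / ereal (ln (ln (real n))))
              = ereal (1 / real CARD('d))"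
    then show "contains_dense_gdelta
            {x. AE y in \<mu>. \<forall>r\<ge>1.
              limsup (\<lambda>n. (abs_ln (nth_closest (riemannian_dist A g) f r n x y)
                            - ereal (1 / real CARD('d) * ln (real n))) / ereal (ln (ln (real n))))
                = ereal (1 / real CARD('d))}"
      by (intro multiple) (rule spec)
  next
    fix \<zeta> :: "nat \<Rightarrow> nat" assume "\<forall>n. \<zeta> n \<ge> 1"
    then show "contains_dense_gdelta
            {x. \<forall>r\<ge>1.
              limsup (\<lambda>n. abs_ln (nth_closest (riemannian_dist A g) f r n x x) / ereal (real (\<zeta> n)))
                = \<infinity>}"
      by (intro generic_self_recurrence) (rule spec)
  qed
qed

end
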